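(* For $n\ge 7$ let $L_n:=\sum_{T\in\mathcal{T}(C_n^3)}|\mathcal{L}(T)|$ be the total number of leaves over all spanning trees of the third power $C_n^3$ of the cycle on $n$ vertices. Then, as formal power series, $$\sum_{m=0}^{\infty} L_{m+7}\,t^m=\frac{A_3}{(t - 1)^3(t^4 + 3t^3 + 6t^2 + 3t + 1)^3(t^4 - 4t^3 - t^2 - 4t + 1)^3},$$ where \begin{align*} A_3&:=-8820t^{26} + 51390t^{25} + 61812t^{24} + 2088t^{23} - 2539950t^{22} - 2981160t^{21} + 2492784t^{20} \\ &+ 45845688t^{19}+ 83018808t^{18}+ 107694630t^{17} - 44892840t^{16} - 166389300t^{15} - 333210654t^{14}\\ & - 121438506t^{13} +42702660t^{12}+ 312824052t^{11}+ 213402930t^{10} + 100784592t^9 - 77616756t^8\\ & - 90041700t^7 - 62209728t^6- 13836186t^5+ 276924t^4 + 2761596t^3+ 501534t^2 + 32592t - 54432. \end{align*}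
   Context: All graphs are finite and simple. $C_n$ is the cycle graph on $n$ vertices. For a graph $G$ and $k\ge1$, the $k$-th power $G^k$ has $V(G^k)=V(G)$, and $uv$ is an edge iff the distance between $u$ and $v$ in $G$ is at least $1$ and at most $k$. $\mathcal{T}(G)$ is the set of labeled spanning trees of $G$ (subgraphs that are trees on all of $V(G)$; isomorphic trees with different labels are different). $\mathcal{L}(T)$ is the set of leaves (vertices of degree exactly $1$ in $T$) of $T$. The family is $\mathcal{C}_k=\{C_n^k : n\ge 2k+1\}$, here with $k=3$; the sequence is indexed so that the constant term of the generating function corresponds to the smallest member $n=2k+1$. *)

theory Defs
  imports
    "HOL-Library.Extended_Nat"
    "HOL-Computational_Algebra.Formal_Power_Series"
begin

(* Edges are two-element sets of vertices. Trees are labelled because graphs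
   are compared by equality, not up to isomorphism. *)
record 'a ugraph =
  vertices :: "'a set"
  edges :: "'a set set"

definition simple_graph :: "'a ugraph \<Rightarrow> bool" where
  "simple_graph G \<longleftrightarrow> finite (vertices G) \<and>
     edges G \<subseteq> {{u, v} | u v. u \<in> vertices G \<and> v \<in> vertices G \<and> u \<noteq> v}"

definition is_walk :: "'a ugraph \<Rightarrow> 'a list \<Rightarrow> bool" where
  "is_walk G p \<longleftrightarrow> p \<noteq> [] \<and> set p \<subseteq> vertices G \<and>
     (\<forall>i. Suc i < length p \<longrightarrow> {p ! i, p ! Suc i} \<in> edges G)"

definition walks_between :: "'a ugraph \<Rightarrow> 'a \<Rightarrow> 'a \<Rightarrow> 'a list set" where
  "walks_between G u v = {p. is_walk G p \<and> hd p = u \<and> last p = v}"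

(* Infinite when there is no walk; a walk through m + 1 vertices has length m. *)
definition gdist :: "'a ugraph \<Rightarrow> 'a \<Rightarrow> 'a \<Rightarrow> enat" where
  "gdist G u v = (INF p \<in> walks_between G u v. enat (length p - 1))"

definition graph_power :: "'a ugraph \<Rightarrow> nat \<Rightarrow> 'a ugraph" where
  "graph_power G k =
     \<lparr>vertices = vertices G,
      edges = {{u, v} | u v. u \<in> vertices G \<and> v \<in> vertices G \<and>
                 1 \<le> gdist G u v \<and> gdist G u v \<le> enat k}\<rparr>"

(* A cycle graph in the usual sense only for n \<ge> 3. *)
definition cycle_graph :: "nat \<Rightarrow> nat ugraph" where
  "cycle_graph n =
     \<lparr>vertices = {0..<n}, edges = {{i, Suc i mod n} | i. i < n}\<rparr>"

definition connected_graph :: "'a ugraph \<Rightarrow> bool" where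
  "connected_graph G \<longleftrightarrow> vertices G \<noteq> {} \<and>
     (\<forall>u\<in>vertices G. \<forall>v\<in>vertices G. walks_between G u v \<noteq> {})"

(* The vertices of the cycle are listed once each; the closing edge joins the
   last one to the first. *)
definition is_graph_cycle :: "'a ugraph \<Rightarrow> 'a list \<Rightarrow> bool" where
  "is_graph_cycle G p \<longleftrightarrow> is_walk G p \<and> 3 \<le> length p \<and> distinct p \<and>
     {last p, hd p} \<in> edges G"

definition tree_graph :: "'a ugraph \<Rightarrow> bool" where
  "tree_graph T \<longleftrightarrow> simple_graph T \<and> connected_graph T \<and> (\<nexists>p. is_graph_cycle T p)"

definition spanning_trees :: "'a ugraph \<Rightarrow> 'a ugraph set" where
  "spanning_trees G =
     {T. tree_graph T \<and> vertices T = vertices G \<and> edges T \<subseteq> edges G}"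

definition vdegree :: "'a ugraph \<Rightarrow> 'a \<Rightarrow> nat" where
  "vdegree G v = card {e \<in> edges G. v \<in> e}"

definition leaves :: "'a ugraph \<Rightarrow> 'a set" where
  "leaves T = {v \<in> vertices T. vdegree T v = 1}"

definition total_leaves :: "'a ugraph \<Rightarrow> nat" where
  "total_leaves G = (\<Sum>T\<in>spanning_trees G. card (leaves T))"

end

theory Submission
  imports Defs
begin

text \<open>
  Every leaf of a spanning tree can be plucked off. A spanning tree with leaf \<open>v\<close> is a
  spanning tree of the graph without \<open>v\<close> together with one of the edges at \<open>v\<close>
  (\<open>card_trees_with_leaf\<close>). In the cube of a cycle on \<open>n\<close> vertices each vertex has degree
  6 and all vertices are alike, so the total number of leaves is \<open>6 * n\<close> times the number of
  spanning trees of the graph \<open>H\<close> that is left when one vertex is removed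
  (\<open>total_leaves_cycle_cube\<close>).

  The graph \<open>H\<close> is the cube of a path with three additional edges between its first two and
  its last two vertices. Its spanning trees are counted by a transfer matrix. The vertices are
  added along the path; whether an edge may be added to a forest depends only on whether its
  endpoints are already connected, and edges that are still to come touch only the first two and
  the last three vertices present. So the state of the process is a partition of these five
  vertices (\<open>num_connected_edges_from\<close>), and there are 52 of them. A computation shows
  that the vector of the numbers of completions of all states satisfies a linear recurrence of
  order 18, whose characteristic polynomial is the square of
  \<open>R = (t - 1) * (t^4 + 3 * t^3 + 6 * t^2 + 3 * t + 1) * (t^4 - 4 * t^3 - t^2 - 4 * t + 1)\<close>.
  It suffices to check this at the first vector, because the transfer matrix maps each vector to
  the next (\<open>completions_recurrence\<close>).

  Hence the generating function \<open>B\<close> of the number of spanning trees of \<open>H\<close>, starting with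
  \<open>n = 7\<close>, is \<open>P / R^2\<close> for a polynomial \<open>P\<close> that is read off from the first 18
  values (\<open>cut_tree_fps_eq\<close>). The factor \<open>6 * n\<close> turns it into
  \<open>6 * (t * B' + 7 * B)\<close>, which the quotient rule writes as a polynomial over \<open>R^3\<close>.
\<close>

section \<open>Connectivity and forests\<close>

definition conn :: "'a set set \<Rightarrow> 'a \<Rightarrow> 'a \<Rightarrow> bool" where
  "conn S x y \<longleftrightarrow> (x, y) \<in> {(u, v). {u, v} \<in> S}\<^sup>*"

lemma conn_refl [simp]: "conn S x x"
  by (simp add: conn_def)

lemma conn_trans: "conn S x y \<Longrightarrow> conn S y z \<Longrightarrow> conn S x z"
  by (auto simp: conn_def)

lemma conn_sym: "conn S x y \<Longrightarrow> conn S y x"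
proof -
  have "sym ({(u, v). {u, v} \<in> S}\<^sup>*)"
    by (intro sym_rtrancl symI) (auto simp: insert_commute)
  then show "conn S x y \<Longrightarrow> conn S y x" by (auto simp: conn_def dest: symD)
qed

lemma conn_edge: "{x, y} \<in> S \<Longrightarrow> conn S x y"
  by (auto simp: conn_def)

lemma conn_mono: "conn S x y \<Longrightarrow> S \<subseteq> S' \<Longrightarrow> conn S' x y"
  unfolding conn_def by (erule rtrancl_mono [THEN subsetD, rotated]) auto

lemma conn_induct [consumes 1, case_names refl step]:
  assumes "conn S x y" "P x" "\<And>y z. conn S x y \<Longrightarrow> P y \<Longrightarrow> {y, z} \<in> S \<Longrightarrow> P z"
  shows "P y"
  using assms(1)[unfolded conn_def]
  by (induction rule: rtrancl_induct) (auto simp: conn_def intro: assms(2,3))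

lemma conn_insert:
  "conn (insert {a, b} S) x y \<longleftrightarrow>
     conn S x y \<or> conn S x a \<and> conn S b y \<or> conn S x b \<and> conn S a y" (is "?l \<longleftrightarrow> ?r y")
proof
  assume ?l
  then show "?r y"
  proof (induction rule: conn_induct)
    case (step y z)
    from step.hyps(2) consider "{y, z} \<in> S" | "y = a" "z = b" | "y = b" "z = a"
      by (auto simp: doubleton_eq_iff)
    then show ?case
      using step.IH by cases (meson conn_refl conn_edge conn_sym conn_trans)+
  qed simp
next
  have ab: "conn (insert {a, b} S) a b" by (rule conn_edge) simp
  have "conn (insert {a, b} S) u v" if "conn S u v" for u v
    using that by (rule conn_mono) auto
  moreover assume "?r y"
  ultimately show ?l using ab by (meson conn_sym conn_trans)
qed

text \<open>
  Used for the endpoint of a pendant edge: before the edge is added, that vertex is reachable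
  only from itself.
\<close>

lemma conn_isolated:
  assumes "conn S x y" "v \<notin> \<Union>S" shows "x = v \<longleftrightarrow> y = v"
  using assms by (induction rule: conn_induct) auto

text \<open>
  Acyclicity in terms of connectivity alone: an edge lies on a cycle exactly if its endpoints
  stay connected after it is deleted. Taking this as the definition leaves only relational
  reasoning about \<open>conn\<close>; cyclic vertex lists are confined to \<open>no_cycle_iff_forest\<close>.
\<close>

definition forest :: "'a set set \<Rightarrow> bool" where
  "forest S \<longleftrightarrow> (\<forall>a b. {a, b} \<in> S \<longrightarrow> \<not> conn (S - {{a, b}}) a b)"

lemma forest_empty [simp]: "forest {}"
  by (simp add: forest_def)

lemma forest_mono: "forest S' \<Longrightarrow> S \<subseteq> S' \<Longrightarrow> forest S"
  unfolding forest_def by (meson Diff_mono conn_mono subsetD subset_refl)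

text \<open>
  This is what makes forests countable edge by edge: a new edge is harmless exactly if it joins
  two different components, so only the partition into components has to be remembered.
\<close>

lemma forest_insert:
  assumes "{a, b} \<notin> S"
  shows "forest (insert {a, b} S) \<longleftrightarrow> forest S \<and> \<not> conn S a b" (is "?l \<longleftrightarrow> ?r")
proof
  assume l: ?l
  then have "\<not> conn (insert {a, b} S - {{a, b}}) a b" unfolding forest_def by blast
  with assms l show ?r by (auto intro: forest_mono)
next
  assume r: ?r
  show ?l unfolding forest_def
  proof (intro allI impI)
    fix c d assume "{c, d} \<in> insert {a, b} S"
    then consider "{c, d} = {a, b}" | "{c, d} \<in> S" "{c, d} \<noteq> {a, b}" by blast
    then show "\<not> conn (insert {a, b} S - {{c, d}}) c d"
    proof cases
      case 1
      then have "conn S c d \<longleftrightarrow> conn S a b" by (auto simp: doubleton_eq_iff dest: conn_sym)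
      with 1 assms r show ?thesis by simp
    next
      case 2
      let ?S = "S - {{c, d}}"
      have eq: "insert {a, b} S - {{c, d}} = insert {a, b} ?S" using 2 by auto
      have no: "\<not> conn ?S c d" using r 2 by (auto simp: forest_def)
      have up: "conn S u v" if "conn ?S u v" for u v using that by (rule conn_mono) auto
      show ?thesis
      proof
        assume "conn (insert {a, b} S - {{c, d}}) c d"
        then have "conn ?S c a \<and> conn ?S b d \<or> conn ?S c b \<and> conn ?S a d"
          using no unfolding eq conn_insert by blast
        then have "conn S a b"
          using up conn_edge[OF 2(1)] by (meson conn_sym conn_trans)
        with r show False by simp
      qed
    qed
  qed
qed

lemma walk_conn:
  "successively (\<lambda>u v. {u, v} \<in> S) p \<Longrightarrow> p \<noteq> [] \<Longrightarrow> conn S (hd p) (last p)"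
proof (induction p)
  case (Cons x p)
  show ?case
  proof (cases "p = []")
    case False
    with Cons.prems have "{x, hd p} \<in> S" "successively (\<lambda>u v. {u, v} \<in> S) p"
      by (auto simp: successively_Cons)
    with Cons.IH False show ?thesis by (auto intro: conn_trans conn_edge)
  qed simp
qed simp

lemma conn_path:
  assumes "conn S x y"
  obtains p where "p \<noteq> []" "hd p = x" "last p = y" "distinct p"
    "successively (\<lambda>u v. {u, v} \<in> S) p" "set p \<subseteq> insert x (\<Union>S)"
proof -
  have "\<exists>p. p \<noteq> [] \<and> hd p = x \<and> last p = y \<and> distinct p \<and>
      successively (\<lambda>u v. {u, v} \<in> S) p \<and> set p \<subseteq> insert x (\<Union>S)"
    using assms
  proof (induction rule: conn_induct)
    case refl
    show ?case by (intro exI[of _ "[x]"]) auto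
  next
    case (step y z)
    then obtain p where p: "p \<noteq> []" "hd p = x" "last p = y" "distinct p"
      "successively (\<lambda>u v. {u, v} \<in> S) p" "set p \<subseteq> insert x (\<Union>S)" by blast
    show ?case
    proof (cases "z \<in> set p")
      case True
      then obtain q r where "p = q @ z # r" by (auto simp: in_set_conv_decomp)
      with p show ?thesis
        by (intro exI[of _ "q @ [z]"]) (auto simp: successively_append_iff hd_append)
    next
      case False
      with p step.hyps show ?thesis
        by (intro exI[of _ "p @ [z]"]) (auto simp: successively_append_iff)
    qed
  qed
  then show ?thesis using that by blast
qed

lemma is_walk_iff:
  "is_walk G p \<longleftrightarrow> p \<noteq> [] \<and> set p \<subseteq> vertices G \<and> successively (\<lambda>u v. {u, v} \<in> edges G) p"
  by (auto simp: is_walk_def successively_conv_nth)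

lemma simple_graphD:
  assumes "simple_graph G" "{a, b} \<in> edges G"
  shows "a \<noteq> b" "a \<in> vertices G" "b \<in> vertices G"
  using assms by (auto simp: simple_graph_def doubleton_eq_iff dest!: subsetD)

lemma Union_edges: "simple_graph G \<Longrightarrow> \<Union>(edges G) \<subseteq> vertices G"
  by (auto simp: simple_graph_def dest!: subsetD)

text \<open>
  A cycle connects the endpoints of its closing edge along its other edges; conversely, a simple
  path between the endpoints of an edge that avoids this edge closes up to a cycle. Such a path
  has at least three vertices, because its endpoints differ and are joined only by the
  removed edge.
\<close>

lemma no_cycle_iff_forest:
  assumes "simple_graph G"
  shows "(\<nexists>p. is_graph_cycle G p) \<longleftrightarrow> forest (edges G)"
proof -
  have "\<not> forest (edges G)" if "is_graph_cycle G p" for p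
  proof -
    let ?e = "{last p, hd p}"
    from that have p: "3 \<le> length p" "distinct p" "?e \<in> edges G"
      "\<forall>i. Suc i < length p \<longrightarrow> {p ! i, p ! Suc i} \<in> edges G" "p \<noteq> []"
      by (auto simp: is_graph_cycle_def is_walk_def)
    have "{p ! i, p ! Suc i} \<noteq> ?e" if "Suc i < length p" for i
    proof
      assume "{p ! i, p ! Suc i} = ?e"
      then have "p ! i = p ! 0 \<and> p ! Suc i = p ! (length p - 1) \<or>
          p ! i = p ! (length p - 1) \<and> p ! Suc i = p ! 0"
        using p(5) by (auto simp: doubleton_eq_iff last_conv_nth hd_conv_nth)
      moreover have "i < length p" "0 < length p" "length p - 1 < length p"
        using p(1) that by auto
      ultimately show False
        using p(1) that by (simp only: nth_eq_iff_index_eq[OF p(2)]) linarith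
    qed
    with p(4) have "successively (\<lambda>u v. {u, v} \<in> edges G - {?e}) p"
      by (auto simp: successively_conv_nth)
    then have "conn (edges G - {?e}) (last p) (hd p)"
      using p(5) by (intro conn_sym[OF walk_conn])
    with p(3) show ?thesis by (auto simp: forest_def)
  qed
  moreover have "\<exists>p. is_graph_cycle G p" if nf: "\<not> forest (edges G)"
  proof -
    from nf obtain a b where ab: "{a, b} \<in> edges G" "conn (edges G - {{a, b}}) a b"
      by (auto simp: forest_def)
    from conn_path[OF ab(2)] obtain p where p: "p \<noteq> []" "hd p = a" "last p = b" "distinct p"
      "successively (\<lambda>u v. {u, v} \<in> edges G - {{a, b}}) p"
      "set p \<subseteq> insert a (\<Union>(edges G - {{a, b}}))" .
    have "a \<noteq> b" using simple_graphD[OF assms ab(1)] by simp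
    have "length p \<noteq> 1" using p \<open>a \<noteq> b\<close> by (auto simp: length_Suc_conv)
    moreover have "length p \<noteq> 2"
      using p by (auto simp: numeral_2_eq_2 length_Suc_conv)
    ultimately have "3 \<le> length p" using p(1) by (cases p; cases "tl p") (auto simp: Suc_le_eq)
    moreover have "set p \<subseteq> vertices G"
      using p(6) Union_edges[OF assms] simple_graphD[OF assms ab(1)] by blast
    moreover have "successively (\<lambda>u v. {u, v} \<in> edges G) p"
      using p(5) by (rule successively_mono) auto
    moreover have "{last p, hd p} \<in> edges G"
      using ab p by (simp add: insert_commute)
    ultimately show ?thesis using p unfolding is_graph_cycle_def is_walk_iff by blast
  qed
  ultimately show ?thesis by blast
qed

lemma tree_graph_iff:
  "tree_graph T \<longleftrightarrow> simple_graph T \<and> vertices T \<noteq> {} \<and> forest (edges T) \<and>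
     (\<forall>x\<in>vertices T. \<forall>y\<in>vertices T. conn (edges T) x y)"
proof -
  have "walks_between T x y \<noteq> {} \<longleftrightarrow> conn (edges T) x y"
    if T: "simple_graph T" and x: "x \<in> vertices T" for x y
  proof
    assume "walks_between T x y \<noteq> {}"
    then show "conn (edges T) x y"
      using walk_conn by (auto simp: walks_between_def is_walk_iff)
  next
    assume "conn (edges T) x y"
    from conn_path[OF this] obtain p where p: "p \<noteq> []" "hd p = x" "last p = y" "distinct p"
      "successively (\<lambda>u v. {u, v} \<in> edges T) p" "set p \<subseteq> insert x (\<Union>(edges T))" .
    then have "p \<in> walks_between T x y"
      using x Union_edges[OF T] by (auto simp: walks_between_def is_walk_iff)
    then show "walks_between T x y \<noteq> {}" by blast
  qed
  then show ?thesis
    unfolding tree_graph_def connected_graph_def using no_cycle_iff_forest by blast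
qed

section \<open>Spanning trees and their leaves\<close>

definition spanning_edge_sets :: "'a set \<Rightarrow> 'a set set \<Rightarrow> 'a set set set" where
  "spanning_edge_sets V E = {S. S \<subseteq> E \<and> forest S \<and> (\<forall>x\<in>V. \<forall>y\<in>V. conn S x y)}"

lemma spanning_trees_eq:
  assumes "simple_graph G" "vertices G \<noteq> {}"
  shows "spanning_trees G =
     (\<lambda>S. \<lparr>vertices = vertices G, edges = S\<rparr>) ` spanning_edge_sets (vertices G) (edges G)"
proof (intro set_eqI iffI)
  fix T assume "T \<in> spanning_trees G"
  then show "T \<in> (\<lambda>S. \<lparr>vertices = vertices G, edges = S\<rparr>) `
      spanning_edge_sets (vertices G) (edges G)"
    by (intro image_eqI[of _ _ "edges T"])
      (auto simp: spanning_trees_def tree_graph_iff spanning_edge_sets_def)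
next
  fix T assume "T \<in> (\<lambda>S. \<lparr>vertices = vertices G, edges = S\<rparr>) `
      spanning_edge_sets (vertices G) (edges G)"
  then obtain S where S: "T = \<lparr>vertices = vertices G, edges = S\<rparr>" "S \<subseteq> edges G" "forest S"
      "\<forall>x\<in>vertices G. \<forall>y\<in>vertices G. conn S x y"
    by (auto simp: spanning_edge_sets_def)
  moreover have "simple_graph T"
    using S(1) order_trans[OF S(2)] assms(1) by (simp add: simple_graph_def)
  ultimately show "T \<in> spanning_trees G"
    using assms(2) by (simp add: spanning_trees_def tree_graph_iff)
qed

lemma finite_edges: "simple_graph G \<Longrightarrow> finite (edges G)"
  using Union_edges[of G] unfolding simple_graph_def by (meson finite_UnionD finite_subset)

text \<open>
  Double counting of the pairs of a spanning tree and one of its leaves.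
\<close>

lemma total_leaves_eq:
  assumes G: "simple_graph G" "vertices G \<noteq> {}"
  shows "total_leaves G = (\<Sum>v\<in>vertices G.
     card {S \<in> spanning_edge_sets (vertices G) (edges G). card {e \<in> S. v \<in> e} = 1})"
proof -
  let ?V = "vertices G" and ?D = "spanning_edge_sets (vertices G) (edges G)"
  have fin: "finite ?V" "finite ?D"
    using G finite_edges[OF G(1)]
    by (auto simp: simple_graph_def spanning_edge_sets_def)
  have "total_leaves G = (\<Sum>S\<in>?D. card {v \<in> ?V. card {e \<in> S. v \<in> e} = 1})"
    unfolding total_leaves_def spanning_trees_eq[OF G]
    by (subst sum.reindex) (auto simp: inj_on_def leaves_def vdegree_def)
  also have "\<dots> = (\<Sum>S\<in>?D. \<Sum>v | v \<in> ?V \<and> card {e \<in> S. v \<in> e} = 1. 1)" by simp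
  also have "\<dots> = (\<Sum>v\<in>?V. \<Sum>S | S \<in> ?D \<and> card {e \<in> S. v \<in> e} = 1. 1)"
    using fin by (rule sum.swap_restrict[rotated])
  finally show ?thesis by simp
qed

text \<open>
  Removing a leaf from a spanning tree leaves a spanning tree of the graph without that vertex,
  and the leaf can be hung back on by any of its edges in the graph; the two choices are
  independent.
\<close>

lemma card_trees_with_leaf:
  assumes E: "E \<subseteq> {{x, y} |x y. x \<in> V \<and> y \<in> V \<and> x \<noteq> y}" and v: "v \<in> V"
    and fin: "finite E"
  shows "card {S \<in> spanning_edge_sets V E. card {e \<in> S. v \<in> e} = 1} =
     card {e \<in> E. v \<in> e} * card (spanning_edge_sets (V - {v}) {e \<in> E. v \<notin> e})"
proof -
  let ?A = "{e \<in> E. v \<in> e}" and ?B = "spanning_edge_sets (V - {v}) {e \<in> E. v \<notin> e}"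
  let ?C = "{S \<in> spanning_edge_sets V E. card {e \<in> S. v \<in> e} = 1}"
  \<comment> \<open>Adding a pendant edge neither creates a cycle nor changes which other vertices are connected.\<close>
  have key: "insert e S \<in> spanning_edge_sets V E \<longleftrightarrow> S \<in> ?B"
    if e: "e \<in> E" "v \<in> e" and S: "S \<subseteq> {e \<in> E. v \<notin> e}" for e S
  proof -
    from e E obtain u where u: "e = {v, u}" "u \<in> V" "u \<noteq> v" by blast
    have iso: "v \<notin> \<Union>S" using S by auto
    have "e \<notin> S" using S e by auto
    then have "forest (insert e S) \<longleftrightarrow> forest S"
      using u conn_isolated[OF _ iso] by (auto simp: forest_insert)
    moreover have "(\<forall>x\<in>V. \<forall>y\<in>V. conn (insert e S) x y) \<longleftrightarrow>
        (\<forall>x\<in>V - {v}. \<forall>y\<in>V - {v}. conn S x y)"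
      unfolding u(1) conn_insert using conn_isolated[OF _ iso] u(2,3)
      by (smt (verit) Diff_iff conn_refl insert_iff singletonD)
    ultimately show ?thesis using e S by (auto simp: spanning_edge_sets_def)
  qed
  have "bij_betw (\<lambda>(e, S). insert e S) (?A \<times> ?B) ?C"
  proof (rule bij_betwI[where g = "\<lambda>S. (THE e. e \<in> S \<and> v \<in> e, {e \<in> S. v \<notin> e})"])
    show "(\<lambda>(e, S). insert e S) \<in> ?A \<times> ?B \<rightarrow> ?C"
    proof clarsimp
      fix e S assume "e \<in> E" "v \<in> e" and S: "S \<in> ?B"
      moreover from S have "S \<subseteq> {e \<in> E. v \<notin> e}" by (auto simp: spanning_edge_sets_def)
      moreover from this \<open>v \<in> e\<close> have "{x. (x = e \<or> x \<in> S) \<and> v \<in> x} = {e}" by auto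
      ultimately show "insert e S \<in> spanning_edge_sets V E \<and>
          card {x. (x = e \<or> x \<in> S) \<and> v \<in> x} = Suc 0" using key by simp
    qed
    show "(\<lambda>S. (THE e. e \<in> S \<and> v \<in> e, {e \<in> S. v \<notin> e})) \<in> ?C \<rightarrow> ?A \<times> ?B"
    proof
      fix S assume S: "S \<in> ?C"
      then obtain e where e: "{e \<in> S. v \<in> e} = {e}" by (auto simp: card_1_singleton_iff)
      have "(THE e. e \<in> S \<and> v \<in> e) = e" using e by (intro the_equality) auto
      moreover have "e \<in> E" "v \<in> e" using e S by (auto simp: spanning_edge_sets_def)
      moreover have "insert e {e \<in> S. v \<notin> e} = S" using e by auto
      moreover have "{e \<in> S. v \<notin> e} \<subseteq> {e \<in> E. v \<notin> e}"
        using S by (auto simp: spanning_edge_sets_def)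
      ultimately show "(THE e. e \<in> S \<and> v \<in> e, {e \<in> S. v \<notin> e}) \<in> ?A \<times> ?B"
        using key[of e "{e \<in> S. v \<notin> e}"] S by simp
    qed
    fix x assume x: "x \<in> ?A \<times> ?B"
    then obtain e S where x: "x = (e, S)" "v \<in> e" "\<forall>s\<in>S. v \<notin> s"
      by (auto simp: spanning_edge_sets_def)
    then show "(THE e'. e' \<in> (case x of (e, S) \<Rightarrow> insert e S) \<and> v \<in> e',
        {e \<in> case x of (e, S) \<Rightarrow> insert e S. v \<notin> e}) = x"
      by (auto intro!: the_equality)
  next
    fix S assume "S \<in> ?C"
    then obtain e where e: "{e \<in> S. v \<in> e} = {e}" by (auto simp: card_1_singleton_iff)
    have "(THE e. e \<in> S \<and> v \<in> e) = e" using e by (intro the_equality) auto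
    with e show "(case (THE e. e \<in> S \<and> v \<in> e, {e \<in> S. v \<notin> e}) of (e, S) \<Rightarrow> insert e S) = S"
      by auto
  qed
  then show ?thesis by (simp add: bij_betw_same_card[symmetric] card_cartesian_product)
qed

section \<open>Counting spanning trees edge by edge\<close>

definition relabel :: "int \<Rightarrow> int \<Rightarrow> int \<Rightarrow> int" where
  "relabel a b x = (if x = b then a else x)"

text \<open>
  Vertices are numbered, and a forest is represented by a labelling in which two vertices have
  the same label iff they are in the same component. For each edge in turn there is the choice
  to leave it out, or to take it and merge the labels of its endpoints if they differ. The list
  contains one final labelling for each forest that arises.
\<close>

fun outcomes :: "(nat \<times> nat) list \<Rightarrow> (nat \<Rightarrow> int) \<Rightarrow> (nat \<Rightarrow> int) list" where
  "outcomes [] f = [f]"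
| "outcomes ((i, j) # es) f = outcomes es f @
     (if f i = f j then [] else outcomes es (\<lambda>k. relabel (f i) (f j) (f k)))"

lemma outcomes_append:
  "outcomes (es @ es') f = concat (map (outcomes es') (outcomes es f))"
  by (induction es f rule: outcomes.induct) auto

lemma outcomes_coarser:
  "g \<in> set (outcomes es f) \<Longrightarrow> f i = f j \<Longrightarrow> g i = g j"
  by (induction es f rule: outcomes.induct) (auto split: if_splits)

definition constant_below :: "nat \<Rightarrow> (nat \<Rightarrow> int) \<Rightarrow> bool" where
  "constant_below N g \<longleftrightarrow> (\<forall>i<N. \<forall>j<N. g i = g j)"

definition num_connected :: "nat \<Rightarrow> (nat \<times> nat) list \<Rightarrow> (nat \<Rightarrow> int) \<Rightarrow> nat" where
  "num_connected N es f = length (filter (constant_below N) (outcomes es f))"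

lemma num_connected_append:
  "num_connected N (es @ es') f = (\<Sum>g\<leftarrow>outcomes es f. num_connected N es' g)"
  by (simp add: num_connected_def outcomes_append filter_concat length_concat o_def)

definition tree_completions :: "'a set \<Rightarrow> 'a set set \<Rightarrow> 'a set set \<Rightarrow> 'a set set set" where
  "tree_completions V S0 E =
     {S. S \<subseteq> E \<and> forest (S0 \<union> S) \<and> (\<forall>x\<in>V. \<forall>y\<in>V. conn (S0 \<union> S) x y)}"

text \<open>
  Deletion and contraction: a completion either avoids \<open>e\<close>, or it is \<open>e\<close>
  together with a completion of the larger set that contains \<open>e\<close> already.
\<close>

lemma card_tree_completions_insert:
  assumes "finite E" "e \<notin> E"
  shows "card (tree_completions V S0 (insert e E)) =
    card (tree_completions V S0 E) + card (tree_completions V (insert e S0) E)"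
proof -
  have without: "tree_completions V S0 (insert e E) \<inter> {S. e \<notin> S} = tree_completions V S0 E"
    using assms(2) by (auto simp: tree_completions_def)
  have "bij_betw (insert e) (tree_completions V (insert e S0) E)
      (tree_completions V S0 (insert e E) \<inter> {S. e \<in> S})"
  proof (rule bij_betwI[where g = "\<lambda>S. S - {e}"])
    show "insert e \<in> tree_completions V (insert e S0) E \<rightarrow>
        tree_completions V S0 (insert e E) \<inter> {S. e \<in> S}"
      by (auto simp: tree_completions_def)
    show "(\<lambda>S. S - {e}) \<in> tree_completions V S0 (insert e E) \<inter> {S. e \<in> S} \<rightarrow>
        tree_completions V (insert e S0) E"
    proof
      fix S assume S: "S \<in> tree_completions V S0 (insert e E) \<inter> {S. e \<in> S}"
      then have "insert e S0 \<union> (S - {e}) = S0 \<union> S" by auto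
      with S show "S - {e} \<in> tree_completions V (insert e S0) E"
        unfolding tree_completions_def by auto
    qed
  qed (use assms(2) in \<open>auto simp: tree_completions_def\<close>)
  then have "card (tree_completions V S0 (insert e E) \<inter> {S. e \<in> S}) =
      card (tree_completions V (insert e S0) E)"
    by (simp add: bij_betw_same_card)
  moreover have "finite (tree_completions V S0 (insert e E))"
    using assms(1) by (simp add: tree_completions_def)
  then have "card (tree_completions V S0 (insert e E)) =
      card (tree_completions V S0 (insert e E) \<inter> {S. e \<notin> S}) +
      card (tree_completions V S0 (insert e E) \<inter> {S. e \<in> S})"
    by (subst card_Un_disjoint[symmetric]) (auto intro!: arg_cong[of _ _ card])
  ultimately show ?thesis by (simp add: without)
qed

text \<open>
  The map \<open>\<phi>\<close> places the numbered vertices in the graph. With it, one list of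
  numbered edges serves for all the isomorphic graphs that arise by deleting different vertices
  from the same cycle power.
\<close>

theorem card_tree_completions:
  fixes \<phi> :: "nat \<Rightarrow> 'a"
  defines "ed \<equiv> \<lambda>(i, j). {\<phi> i, \<phi> j}"
  assumes "forest S0" "\<And>i j. i < N \<Longrightarrow> j < N \<Longrightarrow> f i = f j \<longleftrightarrow> conn S0 (\<phi> i) (\<phi> j)"
    and "distinct (map ed es)" "S0 \<inter> ed ` set es = {}" "\<And>i j. (i, j) \<in> set es \<Longrightarrow> i < N \<and> j < N"
  shows "card (tree_completions (\<phi> ` {..<N}) S0 (ed ` set es)) = num_connected N es f"
  using assms(2-)
proof (induction es arbitrary: S0 f)
  case Nil
  have "(\<forall>x\<in>\<phi> ` {..<N}. \<forall>y\<in>\<phi> ` {..<N}. conn S0 x y) \<longleftrightarrow> constant_below N f"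
    using Nil(2) unfolding constant_below_def by blast
  then have "tree_completions (\<phi> ` {..<N}) S0 {} = (if constant_below N f then {{}} else {})"
    using Nil(1) unfolding tree_completions_def subset_empty
    by (intro set_eqI) (simp del: ball_simps cong: conj_cong)
  then show ?case by (simp add: num_connected_def)
next
  case (Cons e es)
  obtain i j where e: "e = (i, j)" by force
  let ?e = "{\<phi> i, \<phi> j}" and ?V = "\<phi> ` {..<N}"
  have ij: "i < N" "j < N" using Cons.prems(5)[of i j] e by auto
  have new: "?e \<notin> ed ` set es" "?e \<notin> S0"
    using Cons.prems(3,4) by (auto simp: e ed_def)
  have IH0: "card (tree_completions ?V S0 (ed ` set es)) = num_connected N es f"
    using Cons.prems by (intro Cons.IH) auto
  have "ed ` set (e # es) = insert ?e (ed ` set es)" by (simp add: e ed_def)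
  then have card: "card (tree_completions ?V S0 (ed ` set (e # es))) =
      num_connected N es f + card (tree_completions ?V (insert ?e S0) (ed ` set es))"
    using new(1) IH0 by (simp add: card_tree_completions_insert)
  show ?case
  proof (cases "f i = f j")
    case True
    then have "\<not> forest (insert ?e S0)"
      using ij Cons.prems(2) new by (simp add: forest_insert)
    then have "tree_completions ?V (insert ?e S0) (ed ` set es) = {}"
      using forest_mono[of "insert ?e S0 \<union> S" "insert ?e S0" for S]
      by (auto simp: tree_completions_def)
    with card True show ?thesis by (simp add: e num_connected_def)
  next
    case False
    have "card (tree_completions ?V (insert ?e S0) (ed ` set es)) =
        num_connected N es (\<lambda>k. relabel (f i) (f j) (f k))"
    proof (rule Cons.IH)
      show "forest (insert ?e S0)"
        using Cons.prems(1,2) False ij new by (simp add: forest_insert)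
      show "relabel (f i) (f j) (f k) = relabel (f i) (f j) (f l) \<longleftrightarrow>
          conn (insert ?e S0) (\<phi> k) (\<phi> l)" if "k < N" "l < N" for k l
        using that ij False by (auto simp: conn_insert relabel_def Cons.prems(2)[symmetric])
      show "insert ?e S0 \<inter> ed ` set es = {}" using new(1) Cons.prems(4) by auto
      show "distinct (map ed es)" using Cons.prems(3) by simp
      show "k < N \<and> l < N" if "(k, l) \<in> set es" for k l using Cons.prems(5)[of k l] that by auto
    qed
    with card False show ?thesis by (simp add: e num_connected_def)
  qed
qed

corollary card_spanning_edge_sets:
  fixes \<phi> :: "nat \<Rightarrow> 'a"
  assumes "inj_on \<phi> {..<N}" "distinct (map (\<lambda>(i, j). {\<phi> i, \<phi> j}) es)"
    and "\<And>i j. (i, j) \<in> set es \<Longrightarrow> i < N \<and> j < N"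
  shows "card (spanning_edge_sets (\<phi> ` {..<N}) ((\<lambda>(i, j). {\<phi> i, \<phi> j}) ` set es)) =
    num_connected N es int"
proof -
  have "spanning_edge_sets V E = tree_completions V {} E" for V and E :: "'a set set"
    by (simp add: spanning_edge_sets_def tree_completions_def)
  moreover have "conn {} x y \<longleftrightarrow> x = y" for x y :: 'a by (simp add: conn_def)
  ultimately show ?thesis
    using assms by (simp only:) (intro card_tree_completions, auto simp: inj_on_eq_iff)
qed

lemma outcomes_avoid:
  assumes "g \<in> set (outcomes es f)" "\<forall>(i, j)\<in>set es. f i \<noteq> c \<and> f j \<noteq> c"
  shows "g k = c \<longleftrightarrow> f k = c"
  using assms
proof (induction es f rule: outcomes.induct)
  case (2 i j es f)
  show ?case
  proof (cases "g \<in> set (outcomes es f)")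
    case False
    then have g: "f i \<noteq> f j" "g \<in> set (outcomes es (\<lambda>k. relabel (f i) (f j) (f k)))"
      using "2.prems"(1) by (auto split: if_splits)
    have eq: "relabel (f i) (f j) (f l) = c \<longleftrightarrow> f l = c" for l
      using "2.prems"(2) by (auto simp: relabel_def)
    have "g k = c \<longleftrightarrow> relabel (f i) (f j) (f k) = c"
      using g "2.prems"(2) by (intro "2.IH"(2)) (simp_all add: eq)
    with eq show ?thesis by simp
  qed (use 2 in auto)
qed simp

text \<open>
  A component that no later edge touches is never joined to the rest.
\<close>

lemma num_connected_isolated:
  assumes "\<forall>(i, j)\<in>set es. f i \<noteq> c \<and> f j \<noteq> c" "k < N" "f k = c" "l < N" "f l \<noteq> c"
  shows "num_connected N es f = 0"
proof -
  have "\<not> constant_below N g" if "g \<in> set (outcomes es f)" for g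
    using outcomes_avoid[OF that assms(1), of k] outcomes_avoid[OF that assms(1), of l] assms(2-)
    unfolding constant_below_def by metis
  then show ?thesis by (simp add: num_connected_def filter_empty_conv)
qed

section \<open>The frontier of a path cube\<close>

text \<open>
  The process of \<open>outcomes\<close> on the finite list of those labels that still matter; edges
  now are pairs of positions in this list.
\<close>

fun merges :: "(nat \<times> nat) list \<Rightarrow> int list \<Rightarrow> int list list" where
  "merges [] L = [L]"
| "merges ((i, j) # es) L = merges es L @
     (if L ! i = L ! j then [] else merges es (map (relabel (L ! i) (L ! j)) L))"

lemma merges_map:
  assumes "\<forall>(i, j)\<in>set es. i < length fr \<and> j < length fr"
  shows "merges es (map f fr) =
    map (\<lambda>g. map g fr) (outcomes (map (\<lambda>(i, j). (fr ! i, fr ! j)) es) f)"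
  using assms
proof (induction es arbitrary: f)
  case (Cons e es)
  obtain i j where e: "e = (i, j)" by force
  with Cons show ?case by (auto simp: o_def)
qed simp

lemma merges_inj:
  assumes "\<forall>(i, j)\<in>set es. i < length L \<and> j < length L" "inj_on h (set L)"
  shows "merges es (map h L) = map (map h) (merges es L)"
  using assms
proof (induction es arbitrary: L)
  case (Cons e es)
  obtain i j where e: "e = (i, j)" by force
  let ?r = "relabel (L ! i) (L ! j)"
  have ij: "L ! i \<in> set L" "L ! j \<in> set L" using Cons.prems by (auto simp: e)
  have eq: "map (relabel (h (L ! i)) (h (L ! j))) (map h L) = map h (map ?r L)"
    using ij Cons.prems(2) by (auto simp: relabel_def inj_on_eq_iff)
  have "set (map ?r L) \<subseteq> set L" using ij by (auto simp: relabel_def)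
  then have "inj_on h (set (map ?r L))" using Cons.prems(2) by (rule inj_on_subset[rotated])
  then have IH2: "merges es (map h (map ?r L)) = map (map h) (merges es (map ?r L))"
    using Cons.prems by (intro Cons.IH) auto
  have "h (L ! i) = h (L ! j) \<longleftrightarrow> L ! i = L ! j" using ij Cons.prems(2) by (simp add: inj_on_eq_iff)
  moreover have "merges es (map h L) = map (map h) (merges es L)"
    using Cons.prems by (intro Cons.IH) auto
  ultimately show ?case
    using Cons.prems(1) eq IH2 by (simp add: e del: map_map)
qed simp

lemma merges_props:
  assumes "M \<in> set (merges es L)" "\<forall>(i, j)\<in>set es. i < length L \<and> j < length L"
  shows "length M = length L \<and> set M \<subseteq> set L"
  using assms
proof (induction es L rule: merges.induct)
  case (2 i j es L)
  have "set (map (relabel (L ! i) (L ! j)) L) \<subseteq> set L"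
    using 2 by (auto simp: relabel_def)
  with 2 show ?case by (auto split: if_splits)
qed simp

text \<open>
  A frontier lists the labels of the vertices \<open>0\<close>, \<open>1\<close>, \<open>k - 3\<close>,
  \<open>k - 2\<close>, \<open>k - 1\<close>. After vertex \<open>k\<close> has been appended with its three
  backward edges, the entry at position 2, for vertex \<open>k - 3\<close>, is the one that no later
  edge needs.
\<close>

definition drop_oldest :: "int list \<Rightarrow> int list" where
  "drop_oldest M = take 2 M @ drop 3 M"

definition fresh_label :: "int list \<Rightarrow> int" where
  "fresh_label L = foldr max L 0 + 1"

lemma fresh_label: "fresh_label L \<notin> set L"
proof -
  have "x \<in> set L \<Longrightarrow> x \<le> foldr max L 0" for x by (induction L) auto
  then show ?thesis by (force simp: fresh_label_def)
qed

definition step_edges :: "(nat \<times> nat) list" where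
  "step_edges = [(2, 5), (3, 5), (4, 5)]"

definition last_edges :: "(nat \<times> nat) list" where
  "last_edges = [(0, 4), (0, 3), (1, 4)]"

text \<open>
  The filter discards the forests in which the vertex that leaves the frontier would be cut
  off for good.
\<close>

definition advance :: "int list \<Rightarrow> int \<Rightarrow> int list list" where
  "advance L x = map drop_oldest (filter (\<lambda>M. M ! 2 \<in> set (drop_oldest M))
     (merges step_edges (L @ [x])))"

text \<open>
  The number of ways in which a forest with frontier labels \<open>L\<close> extends to a spanning
  tree, when \<open>m\<close> vertices are still to come and then the three edges that close the
  path up.
\<close>

fun completions :: "nat \<Rightarrow> int list \<Rightarrow> nat" where
  "completions 0 L = length (filter (\<lambda>M. \<forall>x\<in>set M. \<forall>y\<in>set M. x = y)
     (merges last_edges L))"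
| "completions (Suc m) L = (\<Sum>M\<leftarrow>advance L (fresh_label L). completions m M)"

lemma advance_props:
  assumes "length L = 5" "M \<in> set (advance L x)"
  shows "length M = 5" "set M \<subseteq> insert x (set L)"
proof -
  from assms obtain M' where M': "M = drop_oldest M'"
      "M' \<in> set (merges step_edges (L @ [x]))" by (auto simp: advance_def)
  have "length M' = 6 \<and> set M' \<subseteq> insert x (set L)"
    using merges_props[OF M'(2)] assms(1) by (auto simp: step_edges_def)
  then show "length M = 5" "set M \<subseteq> insert x (set L)"
    using M'(1) by (auto simp: drop_oldest_def dest: in_set_takeD in_set_dropD)
qed

lemma advance_inj:
  assumes "length L = 5" "inj_on h (insert x (set L))"
  shows "advance (map h L) (h x) = map (map h) (advance L x)"
proof -
  let ?es = step_edges
  have "merges ?es (map h (L @ [x])) = map (map h) (merges ?es (L @ [x]))"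
    using assms by (intro merges_inj) (auto simp: step_edges_def)
  moreover have "map h M ! 2 \<in> set (drop_oldest (map h M)) \<longleftrightarrow> M ! 2 \<in> set (drop_oldest M)"
    if "M \<in> set (merges ?es (L @ [x]))" for M
  proof -
    from merges_props[OF that] assms(1) have M: "length M = 6" "set M \<subseteq> insert x (set L)"
      by (auto simp: step_edges_def)
    have "set (drop_oldest M) \<subseteq> set M"
      by (auto simp: drop_oldest_def dest: in_set_takeD in_set_dropD)
    moreover have "M ! 2 \<in> set M" using M(1) by simp
    ultimately have "h (M ! 2) \<in> h ` set (drop_oldest M) \<longleftrightarrow> M ! 2 \<in> set (drop_oldest M)"
      using M(2) inj_on_image_mem_iff[OF assms(2), of "M ! 2" "set (drop_oldest M)"] by blast
    then show ?thesis using M(1) by (simp add: drop_oldest_def take_map drop_map image_Un)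
  qed
  ultimately show ?thesis
    by (simp add: advance_def filter_map o_def drop_oldest_def take_map drop_map cong: filter_cong)
qed

lemma inj_on_insert_upd:
  assumes "inj_on h A" "y \<notin> h ` A"
  shows "inj_on (h(x := y)) (insert x A)"
proof (rule inj_onI)
  fix u v assume "u \<in> insert x A" "v \<in> insert x A" "(h(x := y)) u = (h(x := y)) v"
  with assms show "u = v"
    by (cases "u = x"; cases "v = x") (auto dest: inj_onD)
qed

text \<open>
  Only the pattern of equalities among the labels matters. This is what reduces the counting to
  finitely many states.
\<close>

lemma completions_inj:
  assumes "length L = 5" "inj_on h (set L)"
  shows "completions m (map h L) = completions m L"
  using assms
proof (induction m arbitrary: L h)
  case 0
  let ?es = last_edges
  have "merges ?es (map h L) = map (map h) (merges ?es L)"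
    using 0 by (intro merges_inj) (auto simp: last_edges_def)
  moreover have "(\<forall>x\<in>set (map h M). \<forall>y\<in>set (map h M). x = y) \<longleftrightarrow> (\<forall>x\<in>set M. \<forall>y\<in>set M. x = y)"
    if "M \<in> set (merges ?es L)" for M
  proof -
    have "set M \<subseteq> set L" using merges_props[OF that] 0(1) by (simp add: last_edges_def)
    with 0(2) have "inj_on h (set M)" by (rule inj_on_subset)
    then show ?thesis by (simp add: inj_on_eq_iff)
  qed
  ultimately show ?case by (simp add: filter_map o_def cong: filter_cong)
next
  case (Suc m)
  let ?x = "fresh_label L" and ?y = "fresh_label (map h L)"
  \<comment> \<open>Extending \<open>h\<close> from one fresh label to the other keeps it injective.\<close>
  let ?h = "h(?x := ?y)"
  have L: "map ?h L = map h L" using fresh_label[of L] by auto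
  have inj: "inj_on ?h (insert ?x (set L))"
    using Suc.prems(2) fresh_label[of "map h L"] by (intro inj_on_insert_upd) simp_all
  have "advance (map h L) ?y = map (map ?h) (advance L ?x)"
    using advance_inj[OF Suc.prems(1) inj] L by simp
  moreover have "completions m (map ?h M) = completions m M" if "M \<in> set (advance L ?x)" for M
    using advance_props[OF Suc.prems(1) that] by (intro Suc.IH inj_on_subset[OF inj])
  ultimately show ?case by (simp add: o_def cong: map_cong)
qed

lemma completions_Suc:
  assumes "length L = 5" "x \<notin> set L"
  shows "completions (Suc m) L = (\<Sum>M\<leftarrow>advance L x. completions m M)"
proof -
  let ?y = "fresh_label L"
  let ?h = "(\<lambda>z. z)(x := ?y)"
  have L: "map ?h L = L" using assms(2) by (simp add: map_idI)
  have inj: "inj_on ?h (insert x (set L))"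
    using fresh_label[of L] by (intro inj_on_insert_upd) simp_all
  have "advance L ?y = map (map ?h) (advance L x)"
    using advance_inj[OF assms(1) inj] L by simp
  moreover have "completions m (map ?h M) = completions m M" if "M \<in> set (advance L x)" for M
    using advance_props[OF assms(1) that] by (intro completions_inj inj_on_subset[OF inj])
  ultimately show ?thesis by (simp add: o_def cong: map_cong)
qed

definition back_edges :: "nat \<Rightarrow> (nat \<times> nat) list" where
  "back_edges k = map (\<lambda>i. (i, k)) [k - 3..<k]"

text \<open>
  The cube of a cycle without one vertex is the cube of a path together with these three edges,
  which run past the removed vertex.
\<close>

definition closing_edges :: "nat \<Rightarrow> (nat \<times> nat) list" where
  "closing_edges N = [(0, N - 1), (0, N - 2), (1, N - 1)]"

definition edges_from :: "nat \<Rightarrow> nat \<Rightarrow> (nat \<times> nat) list" where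
  "edges_from N k = concat (map back_edges [k..<N]) @ closing_edges N"

definition frontier :: "nat \<Rightarrow> nat list" where
  "frontier k = [0, 1, k - 3, k - 2, k - 1]"

lemma back_edges_eq: "3 \<le> k \<Longrightarrow> back_edges k = [(k - 3, k), (k - 2, k), (k - 1, k)]"
  by (simp add: back_edges_def upt_conv_Cons Suc_diff_Suc numeral_3_eq_3 numeral_2_eq_2
      eval_nat_numeral)

lemma outcomes_fresh:
  assumes "g \<in> set (outcomes es f)" "\<forall>(i, j)\<in>set es. i < k \<and> j < k"
    "\<forall>l\<ge>k. \<forall>i. f i = f l \<longrightarrow> i = l" "k \<le> l" "g i = g l"
  shows "i = l"
  using assms
proof (induction es f rule: outcomes.induct)
  case (2 a b es f)
  show ?case
  proof (cases "g \<in> set (outcomes es f)")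
    case False
    with 2(3) have g: "f a \<noteq> f b" "g \<in> set (outcomes es (\<lambda>k. relabel (f a) (f b) (f k)))"
      by (auto split: if_splits)
    have "\<forall>l\<ge>k. \<forall>i. relabel (f a) (f b) (f i) = relabel (f a) (f b) (f l) \<longrightarrow> i = l"
    proof (intro allI impI)
      fix l i assume l: "k \<le> l"
        and eq: "relabel (f a) (f b) (f i) = relabel (f a) (f b) (f l)"
      have "f a \<noteq> f l" "f b \<noteq> f l" using 2(4,5) l by fastforce+
      with eq have "f i = f l" by (auto simp: relabel_def split: if_splits)
      with 2(5) l show "i = l" by blast
    qed
    with 2 g show ?thesis by auto
  qed (use 2 in auto)
qed auto

text \<open>
  The frontier determines the number of extensions as long as every vertex before \<open>k\<close>
  shares its label with a frontier vertex and the labels from \<open>k\<close> on are still unused.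
\<close>

theorem num_connected_edges_from:
  assumes "5 \<le> k" "k \<le> N"
    and "\<forall>l\<ge>k. \<forall>i. f i = f l \<longrightarrow> i = l" "\<forall>i<k. f i \<in> set (map f (frontier k))"
  shows "num_connected N (edges_from N k) f = completions (N - k) (map f (frontier k))"
  using assms
proof (induction "N - k" arbitrary: k f)
  case 0
  then have k: "k = N" by simp
  let ?es = last_edges
  have es: "edges_from N k = map (\<lambda>(i, j). (frontier k ! i, frontier k ! j)) ?es"
    using 0 k by (simp add: edges_from_def closing_edges_def frontier_def last_edges_def)
  have fr: "i \<in> set (frontier k) \<Longrightarrow> i < N" for i using 0 k by (auto simp: frontier_def)
  have "constant_below N g \<longleftrightarrow> (\<forall>x\<in>set (map g (frontier k)). \<forall>y\<in>set (map g (frontier k)). x = y)"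
    if g: "g \<in> set (outcomes (edges_from N k) f)" for g
  proof -
    have "\<exists>j\<in>set (frontier k). g i = g j" if "i < N" for i
    proof -
      from 0 k that obtain j where "j \<in> set (frontier k)" "f i = f j" by auto
      with outcomes_coarser[OF g] show ?thesis by blast
    qed
    then show ?thesis using fr unfolding constant_below_def list.set_map ball_simps by metis
  qed
  then have "num_connected N (edges_from N k) f = length (filter
      (\<lambda>g. \<forall>x\<in>set (map g (frontier k)). \<forall>y\<in>set (map g (frontier k)). x = y)
      (outcomes (edges_from N k) f))"
    unfolding num_connected_def by (intro arg_cong[of _ _ length] filter_cong) auto
  moreover have "merges ?es (map f (frontier k)) = map (\<lambda>g. map g (frontier k))
      (outcomes (edges_from N k) f)"
    unfolding es by (rule merges_map) (simp add: frontier_def last_edges_def)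
  ultimately show ?case using k by (simp add: filter_map o_def)
next
  case (Suc m)
  let ?es = step_edges
  have k: "5 \<le> k" "k < N" using Suc by auto
  have m: "N - k = Suc m" "m = N - Suc k" using Suc.hyps(2) by auto
  have es: "back_edges k = map (\<lambda>(i, j). ((frontier k @ [k]) ! i, (frontier k @ [k]) ! j)) ?es"
    using k by (simp add: back_edges_eq frontier_def step_edges_def)
  have split: "edges_from N k = back_edges k @ edges_from N (Suc k)"
    using k by (simp add: edges_from_def upt_conv_Cons)
  have drop: "drop_oldest (map g (frontier k @ [k])) = map g (frontier (Suc k))" for g
    using k by (simp add: drop_oldest_def frontier_def Suc_diff_le numeral_3_eq_3 numeral_2_eq_2)
  have two: "map g (frontier k @ [k]) ! 2 = g (k - 3)" for g by (simp add: frontier_def)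
  \<comment> \<open>After vertex \<open>k\<close> has been processed, either vertex \<open>k - 3\<close> is still represented
    on the frontier, or its component is complete without being everything.\<close>
  have step: "num_connected N (edges_from N (Suc k)) g =
      (if g (k - 3) \<in> set (map g (frontier (Suc k)))
       then completions m (map g (frontier (Suc k))) else 0)"
    if g: "g \<in> set (outcomes (back_edges k) f)" for g
  proof -
    have fresh: "\<forall>l\<ge>Suc k. \<forall>i. g i = g l \<longrightarrow> i = l"
    proof (intro allI impI)
      fix l i assume "Suc k \<le> l" "g i = g l"
      then show "i = l"
        using outcomes_fresh[OF g, of "Suc k" l i] Suc.prems(3) k(1)
        by (simp add: back_edges_eq less_Suc_eq_le)
    qed
    show ?thesis
    proof (cases "g (k - 3) \<in> set (map g (frontier (Suc k)))")
      case True
      have "\<forall>i<Suc k. g i \<in> set (map g (frontier (Suc k)))"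
      proof (intro allI impI)
        fix i assume "i < Suc k"
        then consider "i = k" | "i < k" by linarith
        then show "g i \<in> set (map g (frontier (Suc k)))"
        proof cases
          case 2
          then obtain j where j: "j \<in> set (frontier k)" "f i = f j" using Suc.prems(4) by auto
          have "g i = g j" using g j(2) by (rule outcomes_coarser)
          moreover have "j = k - 3 \<or> j \<in> set (frontier (Suc k))"
            using j(1) k by (auto simp: frontier_def)
          ultimately show ?thesis using True by (metis image_eqI list.set_map)
        qed (simp add: frontier_def)
      qed
      then show ?thesis using Suc.hyps(1)[OF m(2) _ _ fresh] m(2) k True by simp
    next
      case False
      have "g i \<noteq> g (k - 3) \<and> g j \<noteq> g (k - 3)" if "(i, j) \<in> set (edges_from N (Suc k))" for i j
      proof -
        have *: "g i \<noteq> g (k - 3)" if "i \<in> {0, 1} \<or> k - 2 \<le> i" for i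
        proof (cases "Suc k \<le> i")
          case True
          with fresh k show ?thesis by (metis diff_le_self not_less_eq_eq)
        next
          case False
          with that k have "i \<in> set (frontier (Suc k))" by (auto simp: frontier_def)
          with \<open>g (k - 3) \<notin> _\<close> show ?thesis by (metis image_eqI list.set_map)
        qed
        from that have "(i \<in> {0, 1} \<or> k - 2 \<le> i) \<and> (j \<in> {0, 1} \<or> k - 2 \<le> j)"
          using k by (auto simp: edges_from_def back_edges_def closing_edges_def)
        with * show ?thesis by blast
      qed
      then have "num_connected N (edges_from N (Suc k)) g = 0"
        using k False by (intro num_connected_isolated[of _ _ "g (k - 3)" "k - 3" _ 0])
          (auto simp: frontier_def)
      with False show ?thesis by simp
    qed
  qed
  have "f k \<notin> set (map f (frontier k))"
  proof
    assume "f k \<in> set (map f (frontier k))"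
    then obtain i where "i \<in> set (frontier k)" "f i = f k" by auto
    with Suc.prems(3) have "i = k" by blast
    with \<open>i \<in> _\<close> k show False by (auto simp: frontier_def)
  qed
  then have "completions (N - k) (map f (frontier k)) =
      (\<Sum>M\<leftarrow>advance (map f (frontier k)) (f k). completions m M)"
    unfolding m(1) by (intro completions_Suc) (auto simp: frontier_def)
  also have "advance (map f (frontier k)) (f k) =
      map (\<lambda>g. map g (frontier (Suc k)))
        (filter (\<lambda>g. g (k - 3) \<in> set (map g (frontier (Suc k)))) (outcomes (back_edges k) f))"
  proof -
    have "merges ?es (map f (frontier k @ [k])) =
        map (\<lambda>g. map g (frontier k @ [k])) (outcomes (back_edges k) f)"
      unfolding es by (rule merges_map) (simp add: frontier_def step_edges_def)
    then show ?thesis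
      unfolding advance_def by (simp only: map_append list.map filter_map o_def map_map
          flip: drop two)
  qed
  also have "(\<Sum>M\<leftarrow>\<dots>. completions m M) =
      (\<Sum>g\<leftarrow>outcomes (back_edges k) f. num_connected N (edges_from N (Suc k)) g)"
    using step by (simp add: o_def sum_list_map_filter' cong: map_cong)
  finally show ?case by (simp add: split num_connected_append)
qed

definition cut_cube_edges :: "nat \<Rightarrow> (nat \<times> nat) list" where
  "cut_cube_edges N = edges_from N 0"

definition start_patterns :: "int list list" where
  "start_patterns = merges (concat (map back_edges [0..<5])) [0, 1, 2, 3, 4]"

theorem num_connected_cut_cube:
  assumes "5 \<le> N"
  shows "num_connected N (cut_cube_edges N) int = (\<Sum>L\<leftarrow>start_patterns. completions (N - 5) L)"
proof -
  let ?es = "concat (map back_edges [0..<5])"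
  have split: "cut_cube_edges N = ?es @ edges_from N 5"
    using assms upt_add_eq_append[of 0 5 "N - 5"]
    by (simp add: cut_cube_edges_def edges_from_def del: upt_Suc)
  have fr: "frontier 5 = [0..<5]" by (simp add: frontier_def upt_rec)
  have bound: "\<forall>(i, j)\<in>set ?es. i < 5 \<and> j < 5"
    by (auto simp: back_edges_def)
  have es: "map (\<lambda>(i, j). (frontier 5 ! i, frontier 5 ! j)) ?es = ?es"
  proof (rule map_idI)
    fix e assume e: "e \<in> set ?es"
    obtain i j where "e = (i, j)" by force
    moreover from this bound e have "i < 5 \<and> j < 5" by blast
    ultimately show "(case e of (i, j) \<Rightarrow> (frontier 5 ! i, frontier 5 ! j)) = e" by (simp add: fr)
  qed
  have rest: "num_connected N (edges_from N 5) g = completions (N - 5) (map g (frontier 5))"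
    if g: "g \<in> set (outcomes ?es int)" for g
  proof (rule num_connected_edges_from)
    show "\<forall>l\<ge>5. \<forall>i. g i = g l \<longrightarrow> i = l"
      using outcomes_fresh[OF g bound] by auto
    show "\<forall>i<5. g i \<in> set (map g (frontier 5))" by (auto simp: fr)
  qed (use assms in auto)
  have start: "start_patterns = map (\<lambda>g. map g (frontier 5)) (outcomes ?es int)"
  proof -
    have "[0, 1, 2, 3, 4] = map int (frontier 5)" by (simp add: frontier_def)
    then have "start_patterns = merges ?es (map int (frontier 5))" by (simp add: start_patterns_def)
    also have "\<dots> = map (\<lambda>g. map g (frontier 5)) (outcomes ?es int)"
    proof -
      have "length (frontier 5) = 5" by (simp add: frontier_def)
      then show ?thesis using bound merges_map[of ?es "frontier 5" int] by (simp only: es)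
    qed
    finally show ?thesis .
  qed
  have "num_connected N (cut_cube_edges N) int =
      (\<Sum>g\<leftarrow>outcomes ?es int. num_connected N (edges_from N 5) g)"
    by (simp only: split num_connected_append)
  also have "\<dots> = (\<Sum>g\<leftarrow>outcomes ?es int. completions (N - 5) (map g (frontier 5)))"
    using rest by (simp only: cong: map_cong)
  also have "\<dots> = (\<Sum>L\<leftarrow>start_patterns. completions (N - 5) L)"
    by (simp only: start map_map o_def)
  finally show ?thesis .
qed

section \<open>Cubes of cycles\<close>

lemma gdist_le_iff:
  "gdist G u v \<le> enat k \<longleftrightarrow> (\<exists>p\<in>walks_between G u v. length p \<le> Suc k)"
proof
  assume le: "gdist G u v \<le> enat k"
  show "\<exists>p\<in>walks_between G u v. length p \<le> Suc k"
  proof (rule ccontr)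
    assume "\<not> ?thesis"
    then have "enat (Suc k) \<le> enat (length p - 1)" if "p \<in> walks_between G u v" for p
      using that by fastforce
    then have "enat (Suc k) \<le> gdist G u v" unfolding gdist_def by (rule INF_greatest)
    with le have "enat (Suc k) \<le> enat k" by (rule order_trans[rotated])
    then show False by simp
  qed
next
  assume "\<exists>p\<in>walks_between G u v. length p \<le> Suc k"
  then obtain p where p: "p \<in> walks_between G u v" "length p \<le> Suc k" by blast
  then have "gdist G u v \<le> enat (length p - 1)" unfolding gdist_def by (intro INF_lower)
  also have "\<dots> \<le> enat k" using p(2) by simp
  finally show "gdist G u v \<le> enat k" .
qed

lemma gdist_ge_1_iff:
  assumes "u \<in> vertices G"
  shows "1 \<le> gdist G u v \<longleftrightarrow> u \<noteq> v"
proof -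
  have "gdist G u v \<le> enat 0 \<longleftrightarrow> u = v"
  proof
    assume "gdist G u v \<le> enat 0"
    then obtain p where "p \<in> walks_between G u v" "length p \<le> Suc 0"
      unfolding gdist_le_iff by blast
    then show "u = v" by (cases p) (auto simp: walks_between_def is_walk_def)
  next
    assume "u = v"
    with assms have "[u] \<in> walks_between G u v" by (auto simp: walks_between_def is_walk_def)
    then show "gdist G u v \<le> enat 0" unfolding gdist_le_iff by force
  qed
  moreover have "1 \<le> gdist G u v \<longleftrightarrow> \<not> gdist G u v \<le> enat 0"
    by (cases "gdist G u v") (auto simp: one_enat_def)
  ultimately show ?thesis by blast
qed

text \<open>
  For \<open>x\<close>, \<open>y\<close> below \<open>n\<close> this says that their distance around a cycle of length
  \<open>n\<close> is at most \<open>k\<close>: directly, or across the edge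
  that joins the last vertex to the first.
\<close>

definition near :: "nat \<Rightarrow> nat \<Rightarrow> nat \<Rightarrow> nat \<Rightarrow> bool" where
  "near n k x y \<longleftrightarrow> x \<le> y + k \<and> y \<le> x + k \<or> n + x \<le> y + k \<or> n + y \<le> x + k"

lemma near_sym: "near n k x y \<longleftrightarrow> near n k y x"
  by (auto simp: near_def)

lemma Suc_mod_if: "x < n \<Longrightarrow> Suc x mod n = (if Suc x = n then 0 else Suc x)"
  by simp

lemma cycle_graph_edge_iff:
  assumes "x < n" "y < n" "3 \<le> n"
  shows "{x, y} \<in> edges (cycle_graph n) \<longleftrightarrow> x \<noteq> y \<and> near n 1 x y"
proof -
  have "{x, y} \<in> edges (cycle_graph n) \<longleftrightarrow> y = Suc x mod n \<or> x = Suc y mod n"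
    using assms by (auto simp: cycle_graph_def doubleton_eq_iff)
  also have "\<dots> \<longleftrightarrow> x \<noteq> y \<and> near n 1 x y"
    using assms by (auto simp: near_def Suc_mod_if)
  finally show ?thesis .
qed

lemma near_trans:
  assumes "x < n" "y < n" "z < n" "near n i x y" "near n j y z"
  shows "near n (i + j) x z"
  using assms unfolding near_def by linarith

text \<open>
  If the distance is not already smaller, then one of the two cyclic neighbours of \<open>x\<close> is
  nearer to \<open>y\<close>.
\<close>

lemma near_Suc_step:
  assumes "x < n" "y < n" "3 \<le> n" "near n (Suc k) x y"
  obtains "near n k x y"
  | z where "z < n" "x \<noteq> z" "near n 1 x z" "near n k z y"
proof -
  let ?up = "if Suc x = n then 0 else Suc x" and ?down = "if x = 0 then n - 1 else x - 1"
  have "near n k x y \<or> near n k ?up y \<or> near n k ?down y"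
    using assms by (auto simp: near_def)
  moreover have "?up < n" "x \<noteq> ?up" "near n 1 x ?up"
    "?down < n" "x \<noteq> ?down" "near n 1 x ?down"
    using assms by (auto simp: near_def)
  ultimately show ?thesis using that by metis
qed

lemma walk_cycle_graph_near:
  assumes "3 \<le> n" "is_walk (cycle_graph n) p" "length p \<le> Suc k"
  shows "near n k (hd p) (last p)"
  using assms(2,3)
proof (induction p arbitrary: k)
  case Nil
  then show ?case by (simp add: is_walk_def)
next
  case (Cons x p)
  show ?case
  proof (cases "p = []")
    case True
    then show ?thesis by (simp add: near_def)
  next
    case False
    with Cons.prems obtain k' where k: "k = Suc k'" by (cases k) auto
    have p: "is_walk (cycle_graph n) p" "x < n" "set p \<subseteq> {0..<n}" "{x, hd p} \<in> edges (cycle_graph n)"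
      using Cons.prems(1) False by (auto simp: is_walk_iff successively_Cons cycle_graph_def)
    moreover from False p(3) have "hd p < n" "last p < n"
      using subsetD[OF p(3) hd_in_set] subsetD[OF p(3) last_in_set] by simp_all
    moreover have "near n k' (hd p) (last p)"
      using Cons.prems(2) k by (intro Cons.IH p(1)) simp
    ultimately have "near n (1 + k') x (last p)"
      using assms(1) by (intro near_trans[of x n "hd p"]) (auto simp: cycle_graph_edge_iff)
    then show ?thesis using False k by simp
  qed
qed

lemma near_walk_cycle_graph:
  assumes "3 \<le> n" "x < n" "y < n" "near n k x y"
  shows "\<exists>p\<in>walks_between (cycle_graph n) x y. length p \<le> Suc k"
  using assms(2-)
proof (induction k arbitrary: x)
  case 0
  then have "[x] \<in> walks_between (cycle_graph n) x y"
    by (auto simp: near_def walks_between_def is_walk_def cycle_graph_def)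
  then show ?case by force
next
  case (Suc k)
  from Suc.prems(1,2) assms(1) Suc.prems(3) show ?case
  proof (cases rule: near_Suc_step)
    case 1
    from Suc.IH[OF Suc.prems(1,2) this] show ?thesis by (meson le_SucI)
  next
    case (2 z)
    from Suc.IH[OF 2(1) Suc.prems(2) 2(4)]
    obtain p where p: "p \<in> walks_between (cycle_graph n) z y" "length p \<le> Suc k" by blast
    have "{x, z} \<in> edges (cycle_graph n)"
      using 2 Suc.prems assms(1) by (simp add: cycle_graph_edge_iff)
    then have "x # p \<in> walks_between (cycle_graph n) x y"
      using p(1) Suc.prems(1)
      by (auto simp: walks_between_def is_walk_iff successively_Cons cycle_graph_def)
    then show ?thesis using p(2) by force
  qed
qed

lemma graph_power_cycle:
  assumes "3 \<le> n"
  shows "vertices (graph_power (cycle_graph n) k) = {..<n}"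
    and "edges (graph_power (cycle_graph n) k) =
      {{x, y} |x y. x < n \<and> y < n \<and> x \<noteq> y \<and> near n k x y}"
proof -
  have V: "vertices (cycle_graph n) = {..<n}" by (auto simp: cycle_graph_def)
  then show "vertices (graph_power (cycle_graph n) k) = {..<n}" by (simp add: graph_power_def)
  have "1 \<le> gdist (cycle_graph n) x y \<and> gdist (cycle_graph n) x y \<le> enat k \<longleftrightarrow>
      x \<noteq> y \<and> near n k x y" if "x < n" "y < n" for x y
    using walk_cycle_graph_near[OF assms] near_walk_cycle_graph[OF assms that] that(1)
    unfolding gdist_le_iff walks_between_def by (auto simp: gdist_ge_1_iff V)
  then show "edges (graph_power (cycle_graph n) k) =
      {{x, y} |x y. x < n \<and> y < n \<and> x \<noteq> y \<and> near n k x y}"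
    by (simp add: graph_power_def V cong: conj_cong)
qed

lemma rotation_if: "v < n \<Longrightarrow> i < n \<Longrightarrow> (v + i) mod n = (if v + i < n then v + i else v + i - n)"
  for v i n :: nat
  by (simp add: mod_if)

lemma near_rotation:
  assumes "v < n" "i < n" "j < n"
  shows "near n k ((v + i) mod n) ((v + j) mod n) \<longleftrightarrow> near n k i j"
  using assms by (auto simp: rotation_if near_def)

lemma rotation_bij:
  fixes v n :: nat
  assumes "v < n"
  shows "bij_betw (\<lambda>i. (v + i) mod n) {..<n} {..<n}"
proof -
  have "inj_on (\<lambda>i. (v + i) mod n) {..<n}"
    using assms by (auto simp: inj_on_def rotation_if split: if_splits)
  moreover have "(\<lambda>i. (v + i) mod n) ` {..<n} \<subseteq> {..<n}" using assms by auto
  ultimately show ?thesis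
    by (simp add: bij_betw_def endo_inj_surj)
qed

text \<open>
  For \<open>N\<close> at least 6 the closing edges are different from the edges of the path cube.
  In a shorter path some of them would coincide.
\<close>

lemma set_cut_cube_edges:
  assumes "6 \<le> N"
  shows "set (cut_cube_edges N) = {(i, j). i < j \<and> j < N \<and> near (Suc N) 3 i j}"
proof -
  have "set (cut_cube_edges N) =
      {(i, j). i < j \<and> j < N \<and> j \<le> i + 3} \<union> {(0, N - 1), (0, N - 2), (1, N - 1)}"
    by (auto simp: cut_cube_edges_def edges_from_def back_edges_def closing_edges_def)
  also have "\<dots> = {(i, j). i < j \<and> j < N \<and> near (Suc N) 3 i j}"
    using assms by (auto simp: near_def)
  finally show ?thesis .
qed

lemma distinct_cut_cube_edges:
  assumes "6 \<le> N"
  shows "distinct (cut_cube_edges N)"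
proof -
  have path: "distinct (concat (map back_edges [0..<k]))" for k
  proof (induction k)
    case (Suc k)
    have "distinct (back_edges k)" by (simp add: back_edges_def distinct_map inj_on_def)
    with Suc show ?case by (auto simp: back_edges_def)
  qed simp
  then show ?thesis
    using assms by (auto simp: cut_cube_edges_def edges_from_def closing_edges_def back_edges_def)
qed

text \<open>
  Rotating the cycle moves the removed vertex to the last place, so that the remaining ones are
  numbered consecutively from its successor on.
\<close>

lemma cycle_cube_around_vertex:
  assumes n: "7 \<le> n" and v: "v < n"
  defines "E \<equiv> edges (graph_power (cycle_graph n) 3)"
  shows "card {e \<in> E. v \<in> e} = 6"
    and "card (spanning_edge_sets ({..<n} - {v}) {e \<in> E. v \<notin> e}) =
      num_connected (n - 1) (cut_cube_edges (n - 1)) int"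
proof -
  define N where "N = n - 1"
  have N: "n = Suc N" "6 \<le> N" using n by (auto simp: N_def)
  \<comment> \<open>Vertex \<open>0\<close> goes to the successor of \<open>v\<close>, hence vertex \<open>N\<close> to \<open>v\<close> itself.\<close>
  define \<phi> where "\<phi> i = (Suc v mod n + i) mod n" for i
  have w: "Suc v mod n < n" using n by simp
  have bij: "bij_betw \<phi> {..<n} {..<n}" unfolding \<phi>_def using w by (rule rotation_bij)
  then have inj: "inj_on \<phi> {..<n}" and surj: "\<phi> ` {..<n} = {..<n}" by (auto simp: bij_betw_def)
  have vN: "\<phi> N = v"
  proof -
    have "\<phi> N = (Suc v + N) mod n" by (simp add: \<phi>_def mod_add_left_eq)
    also have "Suc v + N = v + n" using N by simp
    finally show ?thesis using v by simp
  qed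
  have E: "E = {{\<phi> i, \<phi> j} |i j. i < n \<and> j < n \<and> i \<noteq> j \<and> near n 3 i j}" (is "_ = ?R")
  proof (intro set_eqI iffI)
    fix e assume "e \<in> E"
    then obtain x y where xy: "e = {x, y}" "x < n" "y < n" "x \<noteq> y" "near n 3 x y"
      using n by (auto simp: E_def graph_power_cycle)
    then obtain i j where ij: "i < n" "x = \<phi> i" "j < n" "y = \<phi> j"
      using surj by (metis (full_types) imageE lessThan_iff)
    moreover have "near n 3 i j"
      using xy(5) ij near_rotation[OF w, of i j] by (simp add: \<phi>_def)
    ultimately show "e \<in> ?R" using xy by blast
  next
    fix e assume "e \<in> ?R"
    then obtain i j where ij: "e = {\<phi> i, \<phi> j}" "i < n" "j < n" "i \<noteq> j" "near n 3 i j" by blast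
    have "\<phi> i \<noteq> \<phi> j" using ij inj_on_eq_iff[OF inj, of i j] by simp
    moreover have "\<phi> i < n" "\<phi> j < n" "near n 3 (\<phi> i) (\<phi> j)"
      using ij near_rotation[OF w, of i j] by (simp_all add: \<phi>_def)
    ultimately show "e \<in> E" using n ij(1) by (auto simp: E_def graph_power_cycle)
  qed
  have in_E: "{\<phi> i, \<phi> j} \<in> E" if "i < n" "j < n" "i \<noteq> j" "near n 3 i j" for i j
    using that unfolding E by blast
  have at_v: "\<phi> i = v \<longleftrightarrow> i = N" if "i < n" for i
    using inj_on_eq_iff[OF inj, of i N] that N vN by auto
  have "{e \<in> E. v \<in> e} = (\<lambda>i. {v, \<phi> i}) ` {i. i < N \<and> near n 3 i N}"
  proof (intro set_eqI iffI)
    fix e assume "e \<in> {e \<in> E. v \<in> e}"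
    then obtain i j where ij: "e = {\<phi> i, \<phi> j}" "i < n" "j < n" "i \<noteq> j" "near n 3 i j" "v \<in> e"
      unfolding E by blast
    then consider "i = N" | "j = N" using at_v by auto
    then show "e \<in> (\<lambda>i. {v, \<phi> i}) ` {i. i < N \<and> near n 3 i N}"
    proof cases
      case 1
      then have "j < N" "near n 3 j N" "e = {v, \<phi> j}"
        using ij N vN near_sym[of n 3 i j] by auto
      then show ?thesis by blast
    next
      case 2
      then have "i < N" "e = {v, \<phi> i}" using ij N vN by auto
      with 2 ij show ?thesis by blast
    qed
  next
    fix e assume "e \<in> (\<lambda>i. {v, \<phi> i}) ` {i. i < N \<and> near n 3 i N}"
    then obtain i where "e = {\<phi> i, \<phi> N}" "i < N" "near n 3 i N" using vN by auto
    then show "e \<in> {e \<in> E. v \<in> e}" using in_E[of i N] N(1) vN by simp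
  qed
  also have "card \<dots> = card {i. i < N \<and> near n 3 i N}"
  proof (rule card_image, rule inj_onI)
    fix i j assume "i \<in> {i. i < N \<and> near n 3 i N}" "j \<in> {i. i < N \<and> near n 3 i N}"
      "{v, \<phi> i} = {v, \<phi> j}"
    then show "i = j" using inj_on_eq_iff[OF inj, of i j] at_v N by (auto simp: doubleton_eq_iff)
  qed
  also have "{i. i < N \<and> near n 3 i N} = {0, 1, 2, N - 3, N - 2, N - 1}"
    using N by (auto simp: near_def)
  also have "card \<dots> = 6"
  proof -
    obtain k where "N = 6 + k" using N(2) le_Suc_ex by blast
    then show ?thesis by (simp add: card_insert_if)
  qed
  finally show "card {e \<in> E. v \<in> e} = 6" .
  have "{..<n} - {v} = \<phi> ` {..<N}"
  proof -
    have "\<phi> ` {..<N} = \<phi> ` ({..<n} - {N})" using N by (auto intro!: arg_cong[of _ _ "image \<phi>"])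
    also have "\<dots> = {..<n} - {v}"
      using N vN surj inj_on_image_set_diff[OF inj, of "{..<n}" "{N}"] by simp
    finally show ?thesis ..
  qed
  moreover have "{e \<in> E. v \<notin> e} = (\<lambda>(i, j). {\<phi> i, \<phi> j}) ` set (cut_cube_edges N)"
  proof (intro set_eqI iffI)
    fix e assume "e \<in> {e \<in> E. v \<notin> e}"
    then obtain i j where ij: "e = {\<phi> i, \<phi> j}" "i < n" "j < n" "i \<noteq> j" "near n 3 i j" "v \<notin> e"
      unfolding E by blast
    then have "i < N" "j < N" using N vN by (auto simp: less_Suc_eq)
    then have "(i, j) \<in> set (cut_cube_edges N) \<or> (j, i) \<in> set (cut_cube_edges N)"
      using ij N near_sym[of n 3 i j] by (auto simp: set_cut_cube_edges)
    with ij(1) show "e \<in> (\<lambda>(i, j). {\<phi> i, \<phi> j}) ` set (cut_cube_edges N)"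
      by (auto simp: insert_commute intro: rev_image_eqI)
  next
    fix e assume "e \<in> (\<lambda>(i, j). {\<phi> i, \<phi> j}) ` set (cut_cube_edges N)"
    then obtain i j where ij: "e = {\<phi> i, \<phi> j}" "i < j" "j < N" "near n 3 i j"
      using N by (auto simp: set_cut_cube_edges)
    then have "v \<notin> e" using N at_v[of i] at_v[of j] by auto
    with ij show "e \<in> {e \<in> E. v \<notin> e}" using in_E[of i j] N(1) by simp
  qed
  moreover have "card (spanning_edge_sets (\<phi> ` {..<N})
      ((\<lambda>(i, j). {\<phi> i, \<phi> j}) ` set (cut_cube_edges N))) = num_connected N (cut_cube_edges N) int"
  proof (rule card_spanning_edge_sets)
    show injN: "inj_on \<phi> {..<N}" using inj by (rule inj_on_subset) (use N in auto)
    have "inj_on (\<lambda>(i, j). {\<phi> i, \<phi> j}) (set (cut_cube_edges N))"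
    proof (rule inj_onI, clarify)
      fix i j k l
      assume "(i, j) \<in> set (cut_cube_edges N)" "(k, l) \<in> set (cut_cube_edges N)"
        and eq: "{\<phi> i, \<phi> j} = {\<phi> k, \<phi> l}"
      then have lt: "i < j" "j < N" "k < l" "l < N" using N(2) by (auto simp: set_cut_cube_edges)
      from eq have "\<phi> i = \<phi> k \<and> \<phi> j = \<phi> l \<or> \<phi> i = \<phi> l \<and> \<phi> j = \<phi> k"
        by (simp add: doubleton_eq_iff)
      then have "i = k \<and> j = l \<or> i = l \<and> j = k"
        using lt inj_onD[OF injN] by fastforce
      with lt show "i = k \<and> j = l" by auto
    qed
    then show "distinct (map (\<lambda>(i, j). {\<phi> i, \<phi> j}) (cut_cube_edges N))"
      using N(2) by (simp add: distinct_map distinct_cut_cube_edges)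
    show "i < N \<and> j < N" if "(i, j) \<in> set (cut_cube_edges N)" for i j
      using that N(2) by (auto simp: set_cut_cube_edges)
  qed
  ultimately show "card (spanning_edge_sets ({..<n} - {v}) {e \<in> E. v \<notin> e}) =
      num_connected (n - 1) (cut_cube_edges (n - 1)) int"
    by (simp add: N_def)
qed

theorem total_leaves_cycle_cube:
  assumes "7 \<le> n"
  shows "total_leaves (graph_power (cycle_graph n) 3) =
    6 * n * num_connected (n - 1) (cut_cube_edges (n - 1)) int"
proof -
  let ?G = "graph_power (cycle_graph n) 3"
  have V: "vertices ?G = {..<n}" using assms by (simp add: graph_power_cycle)
  have sub: "edges ?G \<subseteq> {{x, y} |x y. x \<in> {..<n} \<and> y \<in> {..<n} \<and> x \<noteq> y}"
    using assms by (auto simp: graph_power_cycle)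
  then have simple: "simple_graph ?G" unfolding simple_graph_def V by simp
  have "total_leaves ?G = (\<Sum>v<n.
      card {S \<in> spanning_edge_sets {..<n} (edges ?G). card {e \<in> S. v \<in> e} = 1})"
  proof -
    have "0 \<in> vertices ?G" using V assms by simp
    then have "vertices ?G \<noteq> {}" by blast
    from total_leaves_eq[OF simple this] show ?thesis by (simp only: V)
  qed
  also have "\<dots> = (\<Sum>v<n. 6 * num_connected (n - 1) (cut_cube_edges (n - 1)) int)"
  proof (rule sum.cong)
    fix v assume v: "v \<in> {..<n}"
    then show "card {S \<in> spanning_edge_sets {..<n} (edges ?G). card {e \<in> S. v \<in> e} = 1} =
        6 * num_connected (n - 1) (cut_cube_edges (n - 1)) int"
      using card_trees_with_leaf[OF sub v finite_edges[OF simple]] cycle_cube_around_vertex[OF assms]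
      by simp
  qed simp
  finally show ?thesis by simp
qed

section \<open>The transfer matrix and its recurrence\<close>

fun first_pos :: "int \<Rightarrow> int list \<Rightarrow> int" where
  "first_pos x [] = 0"
| "first_pos x (y # L) = (if x = y then 0 else first_pos x L + 1)"

text \<open>
  The canonical representative of a pattern of equalities: each label is replaced by the first
  position at which it occurs. For length 5 there are 52 of them, the set partitions of the five
  frontier vertices.
\<close>

definition canon :: "int list \<Rightarrow> int list" where
  "canon L = map (\<lambda>x. first_pos x L) L"

fun patterns :: "nat \<Rightarrow> int list list" where
  "patterns 0 = [[]]"
| "patterns (Suc k) =
     concat (map (\<lambda>p. map (\<lambda>x. p @ [x]) (remdups p @ [int k])) (patterns k))"

lemma first_pos_nonneg: "0 \<le> first_pos x L"
  by (induction L) auto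

lemma nth_first_pos: "x \<in> set L \<Longrightarrow> L ! nat (first_pos x L) = x"
proof (induction L)
  case (Cons y L)
  then show ?case using first_pos_nonneg[of x L] by (auto simp: nat_add_distrib)
qed simp

lemma first_pos_append:
  "first_pos x (L @ M) = (if x \<in> set L then first_pos x L else int (length L) + first_pos x M)"
  by (induction L) auto

lemma length_canon [simp]: "length (canon L) = length L"
  by (simp add: canon_def)

lemma canon_in_patterns: "canon L \<in> set (patterns (length L))"
proof (induction L rule: rev_induct)
  case (snoc x L)
  have "canon (L @ [x]) = canon L @ [first_pos x (L @ [x])]"
    by (simp add: canon_def first_pos_append)
  moreover have "first_pos x (L @ [x]) \<in> set (remdups (canon L) @ [int (length L)])"
    by (auto simp: canon_def first_pos_append)
  ultimately show ?case using snoc.IH by (simp only: length_append_singleton patterns.simps) auto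
qed (simp add: canon_def)

lemma completions_canon:
  assumes "length L = 5"
  shows "completions m (canon L) = completions m L"
proof -
  have "inj_on (\<lambda>x. first_pos x L) (set L)"
    by (rule inj_on_inverseI[where g = "\<lambda>k. L ! nat k"]) (rule nth_first_pos)
  with assms show ?thesis unfolding canon_def by (rule completions_inj)
qed

lemma length_patterns: "p \<in> set (patterns k) \<Longrightarrow> length p = k"
  by (induction k arbitrary: p) auto

text \<open>
  The coefficients of the square of
  \<open>(t - 1) * (t^4 + 3 * t^3 + 6 * t^2 + 3 * t + 1) * (t^4 - 4 * t^3 - t^2 - 4 * t + 1)\<close>.
  It is palindromic, so that it can be read in either direction.
\<close>

definition recurrence_coeffs :: "int list" where
  "recurrence_coeffs =
     [1, -4, -8, -18, 120, 252, 483, -72, -272, -964, -272, -72, 483, 252, 120, -18, -8, -4, 1]"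

definition dot :: "int list \<Rightarrow> int list \<Rightarrow> int" where
  "dot xs ys = sum_list (map2 (*) xs ys)"

text \<open>
  The numbers of completions of all 52 patterns form a vector, and appending one more vertex to
  the path multiplies it by a fixed matrix of nonnegative integers.
\<close>

definition column :: "nat \<Rightarrow> int list" where
  "column m = map (\<lambda>L. int (completions m L)) (patterns 5)"

definition transfer_matrix :: "int list list" where
  "transfer_matrix = map (\<lambda>S. map (\<lambda>M. int (count_list S M)) (patterns 5))
     (map (\<lambda>L. map canon (advance L (fresh_label L))) (patterns 5))"

definition mat_vec :: "int list list \<Rightarrow> int list \<Rightarrow> int list" where
  "mat_vec A x = map (\<lambda>r. dot r x) A"

text \<open>
  The value of the polynomial with coefficients \<open>cs\<close> at the matrix \<open>A\<close>, applied to
  \<open>x\<close>. The vector is moved along with the recursion, so that each coefficient costs one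
  matrix-vector product and no power of \<open>A\<close> is formed.
\<close>

fun krylov_sum :: "int list list \<Rightarrow> int list \<Rightarrow> int list \<Rightarrow> int list" where
  "krylov_sum A [] x = map (\<lambda>_. 0) x"
| "krylov_sum A (c # cs) x = map2 (\<lambda>a b. c * a + b) x (krylov_sum A cs (mat_vec A x))"

fun krylov_values :: "int list list \<Rightarrow> int list \<Rightarrow> nat \<Rightarrow> int list \<Rightarrow> int list" where
  "krylov_values A w 0 x = []"
| "krylov_values A w (Suc n) x = dot w x # krylov_values A w n (mat_vec A x)"

text \<open>
  How often each pattern occurs among the forests on the first five vertices.
\<close>

definition start_weights :: "int list" where
  "start_weights = map (\<lambda>P. int (count_list (map canon start_patterns) P)) (patterns 5)"


text \<open>
  The first values of \<open>cut_tree_count\<close> below.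
\<close>

definition initial_counts :: "int list" where
  "initial_counts =
     [245, 1296, 6125, 29427, 141372, 669408, 3164975, 14902272, 69852385, 326474064,
      1521284484, 7069532883, 32775243751, 151616864016, 699973098475, 3225697260675,
      14840049874692, 68166913931136, 312671816935933]"

lemma distinct_patterns_5: "distinct (patterns 5)"
  by code_simp

text \<open>
  The decisive finite computation. Although there are 52 states, the vectors \<open>column m\<close> span
  a space of dimension at most 18: the matrix polynomial of degree 18 with these coefficients
  maps the first of them to zero.
\<close>

lemma krylov_sum_vanishes: "\<forall>x\<in>set (krylov_sum transfer_matrix recurrence_coeffs (column 0)). x = 0"
  by code_simp

lemma krylov_values_eq:
  "krylov_values transfer_matrix start_weights 19 (column 0) = initial_counts"
  by code_simp

lemma int_sum_list: "int (sum_list (map f xs)) = (\<Sum>x\<leftarrow>xs. int (f x))"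
  by (induction xs) auto

lemma sum_sum_list_swap:
  fixes c :: "'i \<Rightarrow> 'a::comm_semiring_0"
  shows "(\<Sum>j\<in>J. c j * (\<Sum>x\<leftarrow>xs. g j x)) = (\<Sum>x\<leftarrow>xs. \<Sum>j\<in>J. c j * g j x)"
  by (induction xs) (simp_all add: distrib_left sum.distrib)

lemma dot_map: "dot (map a xs) (map b xs) = (\<Sum>x\<leftarrow>xs. a x * b x)"
  by (induction xs) (auto simp: dot_def)

lemma sum_list_count_patterns:
  assumes "set xs \<subseteq> set (patterns 5)"
  shows "(\<Sum>x\<leftarrow>xs. int (f x)) =
    dot (map (\<lambda>M. int (count_list xs M)) (patterns 5)) (map (\<lambda>M. int (f M)) (patterns 5))"
proof -
  have "(\<Sum>x\<leftarrow>xs. int (f x)) = int (\<Sum>x\<leftarrow>xs. f x)" by (simp add: int_sum_list)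
  also have "\<dots> = (\<Sum>M\<in>set (patterns 5). int (count_list xs M) * int (f M))"
    using assms by (simp add: sum_list_map_eq_sum_count2)
  also have "\<dots> = (\<Sum>M\<leftarrow>patterns 5. int (count_list xs M) * int (f M))"
    by (rule sum_list_distinct_conv_sum_set[OF distinct_patterns_5, symmetric])
  finally show ?thesis by (simp only: dot_map)
qed

lemma completions_sum_canon:
  assumes "\<And>M. M \<in> set xs \<Longrightarrow> length M = 5"
  shows "(\<Sum>M\<leftarrow>xs. int (completions m M)) =
    dot (map (\<lambda>M. int (count_list (map canon xs) M)) (patterns 5)) (column m)"
proof -
  have "(\<Sum>M\<leftarrow>xs. int (completions m M)) = (\<Sum>M\<leftarrow>map canon xs. int (completions m M))"
    unfolding map_map o_def using assms
    by (intro arg_cong[of _ _ sum_list] map_cong) (simp_all add: completions_canon)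
  also have "\<dots> = dot (map (\<lambda>M. int (count_list (map canon xs) M)) (patterns 5))
      (map (\<lambda>M. int (completions m M)) (patterns 5))"
  proof (rule sum_list_count_patterns)
    have "canon L \<in> set (patterns 5)" if "L \<in> set xs" for L
      using canon_in_patterns[of L] assms[OF that] by simp
    then show "set (map canon xs) \<subseteq> set (patterns 5)" by auto
  qed
  finally show ?thesis by (simp only: column_def)
qed

lemma column_Suc: "column (Suc m) = mat_vec transfer_matrix (column m)"
proof -
  have "int (completions (Suc m) L) = dot (map (\<lambda>M. int (count_list
      (map canon (advance L (fresh_label L))) M)) (patterns 5)) (column m)"
    if "L \<in> set (patterns 5)" for L
  proof -
    have "int (completions (Suc m) L) =
        (\<Sum>M\<leftarrow>advance L (fresh_label L). int (completions m M))"
      by (simp add: int_sum_list)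
    also have "\<dots> = dot (map (\<lambda>M. int (count_list
        (map canon (advance L (fresh_label L))) M)) (patterns 5)) (column m)"
      using advance_props(1)[OF length_patterns[OF that]] by (rule completions_sum_canon)
    finally show ?thesis .
  qed
  then show ?thesis
    unfolding column_def[of "Suc m"] mat_vec_def transfer_matrix_def map_map o_def
    by (intro map_cong refl)
qed

lemma krylov_sum_column:
  "krylov_sum transfer_matrix cs (column m) =
     map (\<lambda>L. \<Sum>j<length cs. cs ! j * int (completions (m + j) L)) (patterns 5)"
proof (induction cs arbitrary: m)
  case Nil
  show ?case by (simp add: column_def del: patterns.simps)
next
  case (Cons c cs)
  have zip: "map2 g (map a xs) (map b xs) = map (\<lambda>x. g (a x) (b x)) xs"
    for g :: "int \<Rightarrow> int \<Rightarrow> int" and a b and xs :: "int list list"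
    by (induction xs) auto
  have "krylov_sum transfer_matrix (c # cs) (column m) =
      map2 (\<lambda>a b. c * a + b) (column m) (krylov_sum transfer_matrix cs (column (Suc m)))"
    by (simp only: krylov_sum.simps column_Suc)
  also have "\<dots> = map (\<lambda>L. c * int (completions m L) +
      (\<Sum>j<length cs. cs ! j * int (completions (Suc m + j) L))) (patterns 5)"
    unfolding Cons.IH unfolding column_def zip ..
  also have "\<dots> = map (\<lambda>L. \<Sum>j<length (c # cs). (c # cs) ! j * int (completions (m + j) L))
      (patterns 5)"
    by (simp add: sum.lessThan_Suc_shift del: sum.lessThan_Suc patterns.simps)
  finally show ?case .
qed

text \<open>
  The relation holds for \<open>m = 0\<close> by computation, and it is inherited by larger \<open>m\<close>
  because \<open>completions\<close> at \<open>Suc m\<close> is a sum of values at \<open>m\<close>.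
\<close>

theorem completions_recurrence:
  assumes "length L = 5"
  shows "(\<Sum>j<length recurrence_coeffs. recurrence_coeffs ! j * int (completions (m + j) L)) = 0"
  using assms
proof (induction m arbitrary: L)
  case 0
  have "set (krylov_sum transfer_matrix recurrence_coeffs (column 0)) =
      (\<lambda>L. \<Sum>j<length recurrence_coeffs. recurrence_coeffs ! j * int (completions (0 + j) L)) `
        set (patterns 5)"
    unfolding krylov_sum_column by simp
  with krylov_sum_vanishes have "\<forall>L\<in>set (patterns 5).
      (\<Sum>j<length recurrence_coeffs. recurrence_coeffs ! j * int (completions (0 + j) L)) = 0"
    by blast
  moreover have "canon L \<in> set (patterns 5)" using canon_in_patterns[of L] 0 by simp
  ultimately show ?case using 0 by (auto simp: completions_canon)
next
  case (Suc m)
  have "int (completions (Suc m + j) L) =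
      (\<Sum>M\<leftarrow>advance L (fresh_label L). int (completions (m + j) M))" for j
    by (simp add: int_sum_list)
  then have "(\<Sum>j<length recurrence_coeffs. recurrence_coeffs ! j * int (completions (Suc m + j) L)) =
      (\<Sum>M\<leftarrow>advance L (fresh_label L). \<Sum>j<length recurrence_coeffs.
         recurrence_coeffs ! j * int (completions (m + j) M))"
    by (simp only: sum_sum_list_swap)
  also have "\<dots> = (\<Sum>M\<leftarrow>advance L (fresh_label L). 0)"
    using advance_props(1)[OF Suc.prems] by (intro arg_cong[of _ _ sum_list] map_cong refl Suc.IH)
  finally show ?case by simp
qed

text \<open>
  The number of spanning trees of the cube of a cycle on \<open>m + 6\<close> vertices with one vertex
  removed: the first five of the remaining vertices have been processed in
  \<open>start_patterns\<close>.
\<close>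

definition cut_tree_count :: "nat \<Rightarrow> nat" where
  "cut_tree_count m = (\<Sum>L\<leftarrow>start_patterns. completions m L)"

lemma length_start_patterns: "L \<in> set start_patterns \<Longrightarrow> length L = 5"
  unfolding start_patterns_def by (drule merges_props) (auto simp: back_edges_def)

lemma cut_tree_count_recurrence:
  "(\<Sum>j<length recurrence_coeffs. recurrence_coeffs ! j * int (cut_tree_count (m + j))) = 0"
proof -
  have "(\<Sum>j<length recurrence_coeffs. recurrence_coeffs ! j * int (cut_tree_count (m + j))) =
      (\<Sum>L\<leftarrow>start_patterns. \<Sum>j<length recurrence_coeffs.
         recurrence_coeffs ! j * int (completions (m + j) L))"
    unfolding cut_tree_count_def int_sum_list sum_sum_list_swap ..
  also have "\<dots> = (\<Sum>L\<leftarrow>start_patterns. 0)"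
    by (intro arg_cong[of _ _ sum_list] map_cong refl completions_recurrence length_start_patterns)
  finally show ?thesis by simp
qed

lemma krylov_values_column:
  "krylov_values transfer_matrix w n (column m) = map (\<lambda>j. dot w (column (m + j))) [0..<n]"
proof (induction n arbitrary: m)
  case (Suc n)
  have "[0..<Suc n] = 0 # map Suc [0..<n]" by (simp add: map_Suc_upt upt_conv_Cons del: upt_Suc)
  then show ?case using Suc.IH[of "Suc m"] by (simp add: column_Suc[symmetric] o_def del: upt_Suc)
qed simp

lemma cut_tree_count_values:
  "map (\<lambda>m. int (cut_tree_count m)) [0..<19] = initial_counts"
proof -
  have "int (cut_tree_count m) = dot start_weights (column m)" for m
    using completions_sum_canon[OF length_start_patterns, of start_patterns m]
    by (simp add: cut_tree_count_def start_weights_def int_sum_list del: map_map)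
  then show ?thesis
    using krylov_values_column[of start_weights 19 0] by (simp only: krylov_values_eq add_0)
qed

section \<open>Generating functions\<close>

unbundle fps_syntax

text \<open>
  A linear recurrence says that the product with the reversed characteristic polynomial has no
  coefficients from \<open>d\<close> on; the right-hand side collects those that remain.
\<close>

lemma fps_linear_recurrence:
  fixes a c :: "nat \<Rightarrow> 'a::comm_ring_1"
  assumes "\<And>m. (\<Sum>j\<le>d. c j * a (m + j)) = 0"
  shows "Abs_fps a * (\<Sum>j\<le>d. fps_const (c j) * fps_X ^ (d - j)) =
    (\<Sum>k<d. fps_const (\<Sum>i\<le>k. c (d - i) * a (k - i)) * fps_X ^ k)"
proof (rule fps_ext)
  fix k
  let ?l = "\<Sum>j\<le>d. c j * (if k < d - j then 0 else a (k - (d - j)))"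
  have "(Abs_fps a * (fps_const (c j) * fps_X ^ (d - j))) $ k =
      c j * (if k < d - j then 0 else a (k - (d - j)))" for j
  proof -
    have "Abs_fps a * (fps_const (c j) * fps_X ^ (d - j)) =
        fps_const (c j) * (Abs_fps a * fps_X ^ (d - j))" by (simp only: ac_simps)
    then show ?thesis by (simp only: fps_mult_left_const_nth fps_X_power_mult_right_nth fps_nth_Abs_fps)
  qed
  then have l: "(Abs_fps a * (\<Sum>j\<le>d. fps_const (c j) * fps_X ^ (d - j))) $ k = ?l"
    by (simp add: sum_distrib_left fps_sum_nth)
  have r: "(\<Sum>k<d. fps_const (\<Sum>i\<le>k. c (d - i) * a (k - i)) * fps_X ^ k) $ k =
      (if k < d then \<Sum>i\<le>k. c (d - i) * a (k - i) else 0)"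
    by (simp add: fps_sum_nth fps_X_power_nth if_distrib cong: if_cong)
  show "(Abs_fps a * (\<Sum>j\<le>d. fps_const (c j) * fps_X ^ (d - j))) $ k =
      (\<Sum>k<d. fps_const (\<Sum>i\<le>k. c (d - i) * a (k - i)) * fps_X ^ k) $ k"
  proof (cases "k < d")
    case True
    have "?l = (\<Sum>j\<le>d. if k < d - j then 0 else c j * a (k - (d - j)))"
      by (intro sum.cong) auto
    also have "\<dots> = (\<Sum>j\<in>{d - k..d}. c j * a (k - (d - j)))"
      by (intro sum.mono_neutral_cong_right) auto
    also have "\<dots> = (\<Sum>i\<le>k. c (d - i) * a (k - i))"
      using True by (intro sum.reindex_bij_witness[of _ "\<lambda>i. d - i" "\<lambda>j. d - j"]) auto
    finally show ?thesis using True by (simp only: l r if_True)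
  next
    case False
    then have "?l = (\<Sum>j\<le>d. c j * a ((k - d) + j))"
      by (intro sum.cong) (auto intro!: arg_cong[of _ _ a])
    with False assms show ?thesis by (simp only: l r if_False)
  qed
qed

definition cut_denominator :: "'a::comm_ring_1 \<Rightarrow> 'a" where
  "cut_denominator t =
     (t - 1) * (t^4 + 3 * t^3 + 6 * t^2 + 3 * t + 1) * (t^4 - 4 * t^3 - t^2 - 4 * t + 1)"

text \<open>
  What remains of the generating function of the tree counts after multiplication with the square
  of \<open>cut_denominator\<close>: by the recurrence, no coefficient survives beyond degree 17.
\<close>

definition cut_numerator :: "'a::comm_ring_1 \<Rightarrow> 'a" where
  "cut_numerator t =
        1296 + 941 * t - 5441 * t^2 - 48664 * t^3 - 86226 * t^4 - 111727 * t^5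
         + 43120 * t^6 + 119460 * t^7 + 251231 * t^8 + 64656 * t^9 - 10031 * t^10 - 132636 * t^11
         - 67648 * t^12 - 28385 * t^13 + 4866 * t^14 + 2152 * t^15 + 929 * t^16 - 245 * t^17"

lemma cut_denominator_square:
  fixes t :: "'a::idom"
  shows "(cut_denominator t)\<^sup>2 =
        1 - 4 * t - 8 * t^2 - 18 * t^3 + 120 * t^4 + 252 * t^5
         + 483 * t^6 - 72 * t^7 - 272 * t^8 - 964 * t^9 - 272 * t^10 - 72 * t^11
         + 483 * t^12 + 252 * t^13 + 120 * t^14 - 18 * t^15 - 8 * t^16 - 4 * t^17
         + t^18"
  unfolding cut_denominator_def by algebra

text \<open>
  The two long factors are the derivatives of \<open>cut_numerator\<close> and \<open>cut_denominator\<close>,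
  and the right-hand side is the numerator of the generating function of the leaves.
\<close>

lemma numerator_identity:
  fixes t :: "'a::idom"
  shows "6 * (t * ((941 - 10882 * t - 145992 * t^2 - 344904 * t^3 - 558635 * t^4 + 258720 * t^5
         + 836220 * t^6 + 2009848 * t^7 + 581904 * t^8 - 100310 * t^9 - 1458996 * t^10 - 811776 * t^11
         - 369005 * t^12 + 68124 * t^13 + 32280 * t^14 + 14864 * t^15 - 4165 * t^16) * cut_denominator t
      - 2 * cut_numerator t * (2 + 12 * t + 63 * t^2 - 126 * t^5 - 42 * t^6 - 16 * t^7
         + 9 * t^8))
      + 7 * cut_numerator t * cut_denominator t) =
    - 8820 * t^26 + 51390 * t^25 + 61812 * t^24 + 2088 * t^23
                 - 2539950 * t^22 - 2981160 * t^21 + 2492784 * t^20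
                 + 45845688 * t^19 + 83018808 * t^18 + 107694630 * t^17
                 - 44892840 * t^16 - 166389300 * t^15 - 333210654 * t^14
                 - 121438506 * t^13 + 42702660 * t^12 + 312824052 * t^11
                 + 213402930 * t^10 + 100784592 * t^9 - 77616756 * t^8
                 - 90041700 * t^7 - 62209728 * t^6 - 13836186 * t^5
                 + 276924 * t^4 + 2761596 * t^3 + 501534 * t^2 + 32592 * t - 54432"
  unfolding cut_denominator_def cut_numerator_def by algebra

lemma fps_deriv_cut_numerator:
  "fps_deriv (cut_numerator fps_X) = (let t = fps_X :: rat fps in
        941 - 10882 * t - 145992 * t^2 - 344904 * t^3 - 558635 * t^4 + 258720 * t^5
         + 836220 * t^6 + 2009848 * t^7 + 581904 * t^8 - 100310 * t^9 - 1458996 * t^10 - 811776 * t^11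
         - 369005 * t^12 + 68124 * t^13 + 32280 * t^14 + 14864 * t^15 - 4165 * t^16)"
  by (simp add: cut_numerator_def fps_deriv_power Let_def flip: numeral_fps_const)

lemma cut_denominator_expand:
  fixes t :: "'a::idom"
  shows "cut_denominator t = - 1 + 2 * t + 6 * t^2 + 21 * t^3 - 21 * t^6 - 6 * t^7
         - 2 * t^8 + t^9"
  unfolding cut_denominator_def by algebra

lemma fps_deriv_cut_denominator:
  "fps_deriv (cut_denominator fps_X) = (let t = fps_X :: rat fps in
        2 + 12 * t + 63 * t^2 - 126 * t^5 - 42 * t^6 - 16 * t^7
         + 9 * t^8)"
  by (simp add: cut_denominator_expand fps_deriv_power Let_def flip: numeral_fps_const)

text \<open>
  For \<open>B = P / R^2\<close>, this is the derivative expression \<open>6 * (x * B' + 7 * B)\<close> with the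
  denominator \<open>R ^ 3\<close> cleared. The derivative of a quotient by a square needs only the third
  power, which is why the final denominator is a cube.
\<close>

lemma quotient_rule_cleared:
  fixes x :: "'a::idom"
  assumes "P = B * R\<^sup>2" "P' = B' * R\<^sup>2 + 2 * B * R * R'"
  shows "6 * (x * B' + 7 * B) * R ^ 3 = 6 * (x * (P' * R - 2 * P * R') + 7 * P * R)"
  unfolding assms by algebra

text \<open>
  The count starts at \<open>Suc m\<close>: the smallest cycle has seven vertices, so that one vertex
  is left to come after the first five.
\<close>

definition cut_tree_fps :: "rat fps" where
  "cut_tree_fps = Abs_fps (\<lambda>m. of_nat (cut_tree_count (Suc m)))"

lemma cut_tree_fps_eq: "cut_tree_fps * (cut_denominator fps_X)\<^sup>2 = cut_numerator fps_X"
proof -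
  define c where "c j = (of_int (recurrence_coeffs ! j) :: rat)" for j
  define a where "a m = (of_nat (cut_tree_count (Suc m)) :: rat)" for m
  have "(\<Sum>j\<le>18. c j * a (m + j)) = 0" for m
  proof -
    have "(\<Sum>j\<le>18. c j * a (m + j)) = of_int (\<Sum>j<length recurrence_coeffs.
        recurrence_coeffs ! j * int (cut_tree_count (Suc m + j)))"
      unfolding of_int_sum by (intro sum.cong) (auto simp: c_def a_def recurrence_coeffs_def)
    then show ?thesis by (simp only: cut_tree_count_recurrence of_int_0)
  qed
  note rec = fps_linear_recurrence[where d = 18 and c = c and a = a, OF this]
  have a: "a k = of_int (initial_counts ! Suc k)" if "k < 18" for k
    unfolding cut_tree_count_values[symmetric] using that by (simp add: a_def del: upt_Suc)
  have den: "(\<Sum>j\<le>18. fps_const (c j) * fps_X ^ (18 - j)) = (cut_denominator fps_X)\<^sup>2"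
    unfolding cut_denominator_square
    by (simp add: c_def recurrence_coeffs_def atMost_nat_numeral flip: numeral_fps_const fps_const_neg)
  have num: "(\<Sum>k<18. fps_const (\<Sum>i\<le>k. c (18 - i) * a (k - i)) * fps_X ^ k) =
      cut_numerator fps_X"
    unfolding cut_numerator_def
    by (simp add: c_def a recurrence_coeffs_def initial_counts_def lessThan_nat_numeral atMost_nat_numeral
        flip: numeral_fps_const fps_const_neg)
  have "cut_tree_fps = Abs_fps a"
    unfolding cut_tree_fps_def by (intro arg_cong[of _ _ Abs_fps] ext) (simp add: a_def)
  with rec show ?thesis by (simp only: den num)
qed

theorem theorem5p2p2:
  shows "(let t = (fps_X :: rat fps);
              A3 = - 8820 * t^26 + 51390 * t^25 + 61812 * t^24 + 2088 * t^23
                 - 2539950 * t^22 - 2981160 * t^21 + 2492784 * t^20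
                 + 45845688 * t^19 + 83018808 * t^18 + 107694630 * t^17
                 - 44892840 * t^16 - 166389300 * t^15 - 333210654 * t^14
                 - 121438506 * t^13 + 42702660 * t^12 + 312824052 * t^11
                 + 213402930 * t^10 + 100784592 * t^9 - 77616756 * t^8
                 - 90041700 * t^7 - 62209728 * t^6 - 13836186 * t^5
                 + 276924 * t^4 + 2761596 * t^3 + 501534 * t^2 + 32592 * t - 54432
          in Abs_fps (\<lambda>m. of_nat (total_leaves (graph_power (cycle_graph (m + 7)) 3)))
             = A3 / ((t - 1)^3 * (t^4 + 3 * t^3 + 6 * t^2 + 3 * t + 1)^3
                       * (t^4 - 4 * t^3 - t^2 - 4 * t + 1)^3))"
proof -
  let ?R = "cut_denominator fps_X :: rat fps" and ?P = "cut_numerator fps_X :: rat fps"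
  let ?B = cut_tree_fps
  define L where
    "L = Abs_fps (\<lambda>m. of_nat (total_leaves (graph_power (cycle_graph (m + 7)) 3)) :: rat)"
  have "total_leaves (graph_power (cycle_graph (m + 7)) 3) = 6 * (m + 7) * cut_tree_count (Suc m)"
    for m
    using total_leaves_cycle_cube[of "m + 7"] num_connected_cut_cube[of "6 + m"]
    by (simp add: cut_tree_count_def del: completions.simps)
  \<comment> \<open>The factor \<open>n\<close> in the coefficients is the effect of \<open>t * d/dt\<close>.\<close>
  then have nth_L: "L $ n = 6 * (of_nat n * ?B $ n + 7 * ?B $ n)" for n
    by (simp add: L_def cut_tree_fps_def algebra_simps)
  moreover have "(6 * (fps_X * fps_deriv ?B + 7 * ?B)) $ n =
      6 * (of_nat n * ?B $ n + 7 * ?B $ n)" for n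
    by (cases n) (simp_all add: numeral_fps_const)
  ultimately have L: "L = 6 * (fps_X * fps_deriv ?B + 7 * ?B)" by (intro fps_ext) (simp only:)
  have "fps_deriv (?B * ?R\<^sup>2) = fps_deriv ?P" by (simp only: cut_tree_fps_eq)
  then have "fps_deriv ?B * ?R\<^sup>2 + 2 * ?B * ?R * fps_deriv ?R = fps_deriv ?P"
    by (simp add: fps_deriv_power power2_eq_square algebra_simps)
  from quotient_rule_cleared[OF cut_tree_fps_eq[symmetric] this[symmetric], of fps_X]
  have "L * ?R ^ 3 = 6 * (fps_X * (fps_deriv ?P * ?R - 2 * ?P * fps_deriv ?R) + 7 * ?P * ?R)"
    by (simp only: L)
  note LR = this[unfolded fps_deriv_cut_numerator fps_deriv_cut_denominator Let_def numerator_identity]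
  have "fps_nth ?R 0 \<noteq> 0" by (simp add: cut_denominator_def)
  then have "?R ^ 3 \<noteq> 0" by auto
  then have "L = L * ?R ^ 3 / ?R ^ 3" by simp
  then show ?thesis
    unfolding LR by (simp only: Let_def L_def cut_denominator_def power_mult_distrib)
qed

end
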